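(* Let $B:\Sigma^*\to\Sigma^*$ be a limit computable function. There is a constant $c$ depending only on $B$ such that for all $x,y\in\Sigma^*$, $$\mathbf{I}(B(x):y) < \mathbf{I}(x:y)+\mathbf{I}(\langle x,y\rangle;\mathcal{H})+c.$$
   Context: $\Sigma=\{0,1\}$, $\Sigma^*$ the finite binary strings, $\perp$ the empty string. $\mathbf{K}(x\mid z)$ is prefix Kolmogorov complexity relative to auxiliary input $z$ (finite string or infinite sequence) with respect to a fixed universal prefix-free machine $U_z$; $\mathbf{K}(x)=\mathbf{K}(x\mid\perp)$. $\langle x,y\rangle$ is a fixed computable encoding of the pair $(x,y)$ as a string and $\mathbf{K}(x,y)=\mathbf{K}(\langle x,y\rangle)$. The symmetric algorithmic mutual information is $\mathbf{I}(x:y)=\mathbf{K}(x)+\mathbf{K}(y)-\mathbf{K}(x,y)$. $\mathcal{H}$ is the halting sequence (characteristic sequence of the domain of $U$), and for a string $w$, $\mathbf{I}(w;\mathcal{H})=\mathbf{K}(w)-\mathbf{K}(w\mid\mathcal{H})$. A function $B:\Sigma^*\to\Sigma^*$ is limit computable if some Turing machine $T$, whenever $B(x)\ne\perp$, on input $x$ eventually writes $B(x)$ on its output tape and never changes it afterward (halting or not); when $B(x)=\perp$, $T$ eventually outputs nothing or changes its output forever. *)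

theory Defs
  imports Main "HOL-Library.Sublist"
begin

text \<open>Binary strings are bool lists; the empty string is []. Strings are
numbered by the bijective base-2 numeration (a computable bijection with nat).\<close>

type_synonym str = "bool list"

definition enc :: "str \<Rightarrow> nat" where
  "enc s = foldl (\<lambda>n b. 2 * n + (if b then 2 else 1)) 0 s"

definition pair_str :: "str \<Rightarrow> str \<Rightarrow> str" where
  "pair_str x y = concat (map (\<lambda>b. [b, b]) x) @ [False, True] @ y"

datatype recf = Zero | Succ | Proj nat | Comp recf "recf list" | Prec recf recf | Mu recf | Orc

inductive eval :: "(nat \<Rightarrow> bool) \<Rightarrow> recf \<Rightarrow> nat list \<Rightarrow> nat \<Rightarrow> bool" for A where
  eval_Zero: "eval A Zero xs 0"
| eval_Succ: "eval A Succ (x # xs) (Suc x)"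
| eval_Proj: "i < length xs \<Longrightarrow> eval A (Proj i) xs (xs ! i)"
| eval_Comp: "list_all2 (\<lambda>g y. eval A g xs y) gs ys \<Longrightarrow> eval A f ys z \<Longrightarrow> eval A (Comp f gs) xs z"
| eval_Prec0: "eval A f xs z \<Longrightarrow> eval A (Prec f g) (0 # xs) z"
| eval_PrecS: "eval A (Prec f g) (n # xs) y \<Longrightarrow> eval A g (y # n # xs) z
      \<Longrightarrow> eval A (Prec f g) (Suc n # xs) z"
| eval_Mu: "eval A f (n # xs) 0 \<Longrightarrow> (\<forall>m<n. \<exists>y. 0 < y \<and> eval A f (m # xs) y)
      \<Longrightarrow> eval A (Mu f) xs n"
| eval_Orc: "eval A Orc (x # xs) (if A x then 1 else 0)"
monos list_all2_mono

definition phi :: "(nat \<Rightarrow> bool) \<Rightarrow> recf \<Rightarrow> str \<Rightarrow> str option" where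
  "phi A r p = (if \<exists>y. eval A r [enc p] (enc y)
                then Some (THE y. eval A r [enc p] (enc y)) else None)"

definition no_oracle :: "nat \<Rightarrow> bool" where
  "no_oracle = (\<lambda>_. False)"

definition prefix_free :: "str set \<Rightarrow> bool" where
  "prefix_free S \<longleftrightarrow> (\<forall>p\<in>S. \<forall>q\<in>S. prefix p q \<longrightarrow> p = q)"

definition universal_pf :: "((nat \<Rightarrow> bool) \<Rightarrow> str \<Rightarrow> str option) \<Rightarrow> bool" where
  "universal_pf U \<longleftrightarrow>
     (\<exists>r. \<forall>A. U A = phi A r) \<and>
     (\<forall>A. prefix_free (dom (U A))) \<and>
     (\<forall>r. (\<forall>A. prefix_free (dom (phi A r))) \<longrightarrow>
          (\<exists>e. \<forall>A p. U A (e @ p) = phi A r p))"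

definition KA :: "((nat \<Rightarrow> bool) \<Rightarrow> str \<Rightarrow> str option) \<Rightarrow> (nat \<Rightarrow> bool) \<Rightarrow> str \<Rightarrow> nat" where
  "KA U A x = (LEAST n. \<exists>p. length p = n \<and> U A p = Some x)"

text \<open>Unconditional complexity: empty auxiliary input = empty oracle.\<close>
definition Kc :: "((nat \<Rightarrow> bool) \<Rightarrow> str \<Rightarrow> str option) \<Rightarrow> str \<Rightarrow> nat" where
  "Kc U x = KA U no_oracle x"

definition halting :: "((nat \<Rightarrow> bool) \<Rightarrow> str \<Rightarrow> str option) \<Rightarrow> nat \<Rightarrow> bool" where
  "halting U n \<longleftrightarrow> (\<exists>p. enc p = n \<and> U no_oracle p \<noteq> None)"

definition mutual_info :: "((nat \<Rightarrow> bool) \<Rightarrow> str \<Rightarrow> str option) \<Rightarrow> str \<Rightarrow> str \<Rightarrow> int" where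
  "mutual_info U x y = int (Kc U x) + int (Kc U y) - int (Kc U (pair_str x y))"

definition info_halting :: "((nat \<Rightarrow> bool) \<Rightarrow> str \<Rightarrow> str option) \<Rightarrow> str \<Rightarrow> int" where
  "info_halting U w = int (Kc U w) - int (KA U (halting U) w)"

text \<open>g x t is the content of the output tape of T on input x after t steps
(a total computable function of (x,t)).\<close>
definition limit_computable :: "(str \<Rightarrow> str) \<Rightarrow> bool" where
  "limit_computable B \<longleftrightarrow> (\<exists>r.
     (\<forall>x t. \<exists>v. eval no_oracle r [enc x, t] v) \<and>
     (\<forall>x. B x \<noteq> [] \<longrightarrow> (\<exists>t0. \<forall>t\<ge>t0. eval no_oracle r [enc x, t] (enc (B x)))) \<and>
     (\<forall>x. B x = [] \<longrightarrow>
          (\<exists>t0. \<forall>t\<ge>t0. eval no_oracle r [enc x, t] (enc [])) \<or>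
          \<not> (\<exists>v t0. \<forall>t\<ge>t0. eval no_oracle r [enc x, t] v)))"

end

(*
  After cancelling K(y) and K(x,y), the claim reads
    K(z) + K(x,y | H) <= K(x) + K(z,y) + O(1)   with z = B(x).
  Let m(z) be the sum of 2^-|p| over all p with U(p) = <z,y> for some y.  Without an oracle, z has a
  code of length -log m(z) + O(1).  With H, one recovers z from a shortest program of x (the query
  "does T still change its output?" decides the limit) and then n = -log m(z) up to a constant;
  given z, the programs p of pairs <z,y> have total weight at most 2^(2-n), so y has a
  Shannon-Fano-Elias code of length K(z,y) - n + O(1).  The two occurrences of n cancel.
  If B(x) is empty, T need not converge, but then z is a constant and K(x,y) <= K(x) + K(z,y) + O(1).
*)
theory Submission
  imports Defs Complex_Main "HOL-Library.Nat_Bijection"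
begin

section \<open>Computable functions relative to an oracle\<close>

\<comment> \<open>Universality of U is available only for machines whose domain is prefix-free under
  every oracle. A decoder that consults H must therefore decode uniquely even under a wrong oracle,
  where the answers mean nothing. So each value drawn from the oracle is the least one that passes a
  test, hence unique whatever the oracle says; only the existence of a short code word uses that the
  oracle is H. Code lengths come from requests handled in a fixed order, each active only at the
  first stage at which its condition holds. This makes activity decidable, so a decoder can compute
  where a slot begins, and it counts every event once, which bounds the sum of the slots. If the
  slots of all programs of pairs <z,y> fit into [0, 2^-k], every code word begins with k zeros, and
  a decoder that knows k supplies them itself. This saves the bits in the code of y given z. The
  number n is exact: the least n with m(z) > 2^(1-n), an inequality that shows at a finite stage and
  that H can therefore decide. The factor 2 in this threshold pays for the geometric series of all
  larger n, which make requests as well.\<close>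
inductive_simps eval_Zero_iff: "eval A Zero xs v"
inductive_simps eval_Succ_iff: "eval A Succ xs v"
inductive_simps eval_Proj_iff: "eval A (Proj i) xs v"
inductive_simps eval_Comp_iff: "eval A (Comp f gs) xs v"
inductive_simps eval_Prec_Nil_iff: "eval A (Prec f g) [] v"
inductive_simps eval_Prec_0_iff: "eval A (Prec f g) (0 # xs) v"
inductive_simps eval_Prec_Suc_iff: "eval A (Prec f g) (Suc n # xs) v"
inductive_simps eval_Mu_iff: "eval A (Mu f) xs v"
inductive_simps eval_Orc_iff: "eval A Orc xs v"

lemmas eval_iffs = eval_Zero_iff eval_Succ_iff eval_Proj_iff eval_Comp_iff eval_Prec_Nil_iff
  eval_Prec_0_iff eval_Prec_Suc_iff eval_Mu_iff eval_Orc_iff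

lemma eval_deterministic: "eval A r xs v \<Longrightarrow> eval A r xs w \<Longrightarrow> v = w"
proof (induction r arbitrary: xs v w)
  case (Comp f gs)
  from Comp.prems obtain ys zs
    where ys: "list_all2 (\<lambda>g y. eval A g xs y) gs ys" "eval A f ys v"
      and zs: "list_all2 (\<lambda>g y. eval A g xs y) gs zs" "eval A f zs w"
    by (auto simp: eval_Comp_iff)
  have "ys = zs"
  proof (rule nth_equalityI)
    show "length ys = length zs"
      using ys(1) zs(1) by (simp add: list_all2_conv_all_nth)
    fix i assume "i < length ys"
    then show "ys ! i = zs ! i"
      using ys(1) zs(1) Comp.IH(2)[of "gs ! i" xs "ys ! i" "zs ! i"]
      by (simp add: list_all2_conv_all_nth)
  qed
  then show ?case using ys zs Comp.IH(1) by blast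
next
  case (Prec f g)
  show ?case
  proof (cases xs)
    case Nil
    then show ?thesis using Prec.prems by (simp add: eval_iffs)
  next
    case (Cons n ys)
    have "eval A (Prec f g) (n # ys) v \<Longrightarrow> eval A (Prec f g) (n # ys) w \<Longrightarrow> v = w" for v w
    proof (induction n arbitrary: v w)
      case 0
      then show ?case using Prec.IH(1) by (simp add: eval_iffs)
    next
      case (Suc n)
      then show ?case using Prec.IH(2) by (fastforce simp: eval_iffs)
    qed
    then show ?thesis using Prec.prems Cons by blast
  qed
next
  case (Mu f)
  then have v: "eval A f (v # xs) 0" "\<And>m. m < v \<Longrightarrow> \<exists>y>0. eval A f (m # xs) y"
    and w: "eval A f (w # xs) 0" "\<And>m. m < w \<Longrightarrow> \<exists>y>0. eval A f (m # xs) y"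
    by (auto simp: eval_Mu_iff)
  show ?case
    using v w Mu.IH by (metis less_irrefl linorder_neqE_nat)
qed (auto simp: eval_iffs)

text \<open>Lets a machine with any oracle rerun a computation that had the empty oracle.
  \<open>Orc\<close> becomes \<open>Comp Zero [Proj 0]\<close> rather than \<open>Zero\<close>,
  because \<open>Orc\<close> has no value on the empty argument list whereas \<open>Zero\<close> has
  one.\<close>

primrec oracle_free :: "recf \<Rightarrow> recf" where
  "oracle_free Zero = Zero"
| "oracle_free Succ = Succ"
| "oracle_free (Proj i) = Proj i"
| "oracle_free (Comp f gs) = Comp (oracle_free f) (map oracle_free gs)"
| "oracle_free (Prec f g) = Prec (oracle_free f) (oracle_free g)"
| "oracle_free (Mu f) = Mu (oracle_free f)"
| "oracle_free Orc = Comp Zero [Proj 0]"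

lemma eval_oracle_free: "eval A (oracle_free r) xs v \<longleftrightarrow> eval no_oracle r xs v"
proof (induction r arbitrary: xs v)
  case (Comp f gs)
  then show ?case by (simp add: eval_Comp_iff list_all2_conv_all_nth)
next
  case (Prec f g)
  show ?case
  proof (cases xs)
    case Nil
    then show ?thesis by (simp add: eval_iffs)
  next
    case (Cons n ys)
    have "eval A (oracle_free (Prec f g)) (n # ys) v \<longleftrightarrow> eval no_oracle (Prec f g) (n # ys) v" for v
      by (induction n arbitrary: v) (use Prec.IH in \<open>simp_all add: eval_iffs\<close>)
    then show ?thesis using Cons by simp
  qed
next
  case (Mu f)
  then show ?case by (simp add: eval_Mu_iff)
next
  case Orc
  show ?case by (cases xs) (auto simp: eval_iffs no_oracle_def list_all2_Cons1)
qed (auto simp: eval_iffs)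

text \<open>Arguments are given by an environment \<open>e\<close> whose entry 0 is the innermost bound variable, so
that the closure rules for binders apply by higher-order unification. Allowing every sufficiently
large arity removes all arity side conditions from these rules.\<close>

definition computable :: "((nat \<Rightarrow> bool) \<Rightarrow> (nat \<Rightarrow> nat) \<Rightarrow> nat) \<Rightarrow> bool" where
  "computable f \<longleftrightarrow> (\<exists>n0. \<forall>n\<ge>n0. \<exists>r. \<forall>A e. eval A r (map e [0..<n]) (f A e))"

definition decidable :: "((nat \<Rightarrow> bool) \<Rightarrow> (nat \<Rightarrow> nat) \<Rightarrow> bool) \<Rightarrow> bool" where
  "decidable P \<longleftrightarrow> computable (\<lambda>A e. of_bool (P A e))"

lemma computable_no_oracle:
  assumes "computable f"
  shows "computable (\<lambda>A e. f no_oracle e)"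
  using assms unfolding computable_def by (metis (no_types) eval_oracle_free)

lemma computable_var: "computable (\<lambda>A e. e i)"
  unfolding computable_def
proof (intro exI[of _ "Suc i"] allI impI)
  fix n assume "Suc i \<le> n"
  then show "\<exists>r. \<forall>A e. eval A r (map e [0..<n]) (e i)"
    by (intro exI[of _ "Proj i"]) (simp add: eval_Proj_iff)
qed

lemma computable_subst:
  assumes "computable F" and "\<And>i. computable (G i)"
  shows "computable (\<lambda>A e. F A (\<lambda>i. G i A e))"
proof -
  obtain m rF where rF: "\<And>A e. eval A rF (map e [0..<m]) (F A e)"
    using assms(1) unfolding computable_def by blast
  obtain k where k: "\<And>i n. n \<ge> k i \<Longrightarrow> \<exists>r. \<forall>A e. eval A r (map e [0..<n]) (G i A e)"
    using assms(2) unfolding computable_def by metis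
  show ?thesis
    unfolding computable_def
  \<comment> \<open>\<open>rF\<close> reads only m entries of its environment, so only finitely many
    \<open>G i\<close> have to be computed, and the sum of their arity thresholds is at least each
    of them.\<close>
  proof (intro exI[of _ "sum k {..<m}"] allI impI)
    fix n assume n: "sum k {..<m} \<le> n"
    have "\<exists>r. \<forall>A e. eval A r (map e [0..<n]) (G i A e)" if "i < m" for i
      using that n member_le_sum[of i "{..<m}" k] by (intro k) simp
    then obtain r where r: "\<And>i A e. i < m \<Longrightarrow> eval A (r i) (map e [0..<n]) (G i A e)"
      by metis
    have "eval A (Comp rF (map r [0..<m])) (map e [0..<n]) (F A (\<lambda>i. G i A e))" for A e
      unfolding eval_Comp_iff using rF[of A "\<lambda>i. G i A e"] r
      by (intro exI[of _ "map (\<lambda>i. G i A e) [0..<m]"]) (auto simp: list_all2_conv_all_nth)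
    then show "\<exists>r. \<forall>A e. eval A r (map e [0..<n]) (F A (\<lambda>i. G i A e))" by blast
  qed
qed

lemma computable_subst_Cons:
  assumes "computable (\<lambda>A e. F A (e 0) (\<lambda>i. e (Suc i)))"
    and "computable T" and "\<And>i. computable (\<lambda>A e. G A e i)"
  shows "computable (\<lambda>A e. F A (T A e) (G A e))"
proof -
  have "computable (\<lambda>A e. case_nat (T A e) (G A e) i)" for i
    using assms(2,3) by (cases i) auto
  from computable_subst[OF assms(1), of "\<lambda>i A e. case_nat (T A e) (G A e) i", OF this]
  show ?thesis by simp
qed

lemma computable_app1:
  assumes "computable (\<lambda>A e. f (e 0))" and "computable a"
  shows "computable (\<lambda>A e. f (a A e))"
  using computable_subst[OF assms(1), of "\<lambda>_. a"] assms(2) by simp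

lemma computable_app2:
  assumes "computable (\<lambda>A e. f (e 0) (e (Suc 0)))" and "computable a" and "computable b"
  shows "computable (\<lambda>A e. f (a A e) (b A e))"
proof -
  have "computable (\<lambda>A e. case_nat (a A e) (\<lambda>_. b A e) i)" for i
    using assms(2,3) by (cases i) auto
  from computable_subst[OF assms(1), of "\<lambda>i A e. case_nat (a A e) (\<lambda>_. b A e) i", OF this]
  show ?thesis by simp
qed

text \<open>\<open>Prec\<close> passes the previous value first and the counter second, hence entry
  0 for \<open>y\<close> and entry 1 for \<open>n\<close> in the hypothesis on
  \<open>h\<close>.\<close>

lemma computable_rec_nat:
  assumes f: "computable f"
    and h: "computable (\<lambda>A e. h A (e (Suc 0)) (e 0) (\<lambda>i. e (Suc (Suc i))))"
    and b: "computable b"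
  shows "computable (\<lambda>A e. rec_nat (f A e) (\<lambda>n y. h A n y e) (b A e))"
proof -
  obtain kf where kf: "\<And>n. n \<ge> kf \<Longrightarrow> \<exists>r. \<forall>A e. eval A r (map e [0..<n]) (f A e)"
    using f unfolding computable_def by blast
  obtain kb where kb: "\<And>n. n \<ge> kb \<Longrightarrow> \<exists>r. \<forall>A e. eval A r (map e [0..<n]) (b A e)"
    using b unfolding computable_def by blast
  obtain kh where kh: "\<And>n. n \<ge> kh \<Longrightarrow>
      \<exists>r. \<forall>A e. eval A r (map e [0..<n]) (h A (e (Suc 0)) (e 0) (\<lambda>i. e (Suc (Suc i))))"
    using h unfolding computable_def by blast
  show ?thesis
    unfolding computable_def
  proof (intro exI[of _ "kf + kb + kh"] allI impI)
    fix n assume n: "kf + kb + kh \<le> n"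
    obtain rf where rf: "\<And>A e. eval A rf (map e [0..<n]) (f A e)"
      using kf[of n] n by auto
    obtain rb where rb: "\<And>A e. eval A rb (map e [0..<n]) (b A e)"
      using kb[of n] n by auto
    obtain rh where rh: "\<And>A e. eval A rh (map e [0..<Suc (Suc n)])
        (h A (e (Suc 0)) (e 0) (\<lambda>i. e (Suc (Suc i))))"
      using kh[of "Suc (Suc n)"] n by auto
    have rh': "eval A rh (y # k # map e [0..<n]) (h A k y e)" for A y k e
    proof -
      have "map (case_nat y (case_nat k e)) [0..<Suc (Suc n)] = y # k # map e [0..<n]"
        by (simp add: map_upt_Suc del: upt_Suc)
      then show ?thesis
        using rh[of A "case_nat y (case_nat k e)"] by simp
    qed
    have rec: "eval A (Prec rf rh) (k # map e [0..<n]) (rec_nat (f A e) (\<lambda>n y. h A n y e) k)" for A k e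
      by (induction k) (use rf rh' in \<open>auto simp: eval_iffs\<close>)
    have "eval A (Comp (Prec rf rh) (rb # map Proj [0..<n])) (map e [0..<n])
        (rec_nat (f A e) (\<lambda>n y. h A n y e) (b A e))" for A e
      unfolding eval_Comp_iff using rec[of A "b A e" e] rb[of A e]
      by (intro exI[of _ "b A e # map e [0..<n]"])
        (auto simp: list_all2_map1 list_all2_map2 list_all2_same eval_Proj_iff)
    then show "\<exists>r. \<forall>A e. eval A r (map e [0..<n]) (rec_nat (f A e) (\<lambda>n y. h A n y e) (b A e))"
      by blast
  qed
qed

lemma computable_Suc:
  assumes "computable f"
  shows "computable (\<lambda>A e. Suc (f A e))"
proof -
  have "computable (\<lambda>A e. Suc (e 0))"
    unfolding computable_def
  proof (intro exI[of _ "Suc 0"] allI impI)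
    fix n assume "Suc 0 \<le> n"
    then have "map e [0..<n] = e 0 # map e [Suc 0..<n]" for e :: "nat \<Rightarrow> nat"
      by (simp add: upt_conv_Cons)
    then show "\<exists>r. \<forall>A e. eval A r (map e [0..<n]) (Suc (e 0))"
      by (intro exI[of _ Succ]) (simp add: eval_Succ_iff)
  qed
  from computable_app1[OF this assms] show ?thesis .
qed

lemma computable_const: "computable (\<lambda>A e. k)"
proof (induction k)
  case 0
  show ?case unfolding computable_def by (metis eval_Zero)
next
  case (Suc k)
  from computable_Suc[OF this] show ?case .
qed

lemma decidable_oracle:
  assumes "computable f"
  shows "decidable (\<lambda>A e. A (f A e))"
proof -
  have "computable (\<lambda>A e. of_bool (A (e 0)))"
    unfolding computable_def
  proof (intro exI[of _ "Suc 0"] allI impI)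
    fix n assume "Suc 0 \<le> n"
    then have "map e [0..<n] = e 0 # map e [Suc 0..<n]" for e :: "nat \<Rightarrow> nat"
      by (simp add: upt_conv_Cons)
    then show "\<exists>r. \<forall>A e. eval A r (map e [0..<n]) (of_bool (A (e 0)))"
      by (intro exI[of _ Orc]) (simp add: eval_Orc_iff)
  qed
  from computable_subst[OF this, of "\<lambda>_. f"] assms show ?thesis
    unfolding decidable_def by simp
qed

lemma computable_add:
  assumes "computable f" "computable g"
  shows "computable (\<lambda>A e. f A e + g A e)"
proof -
  have eq: "m + n = rec_nat m (\<lambda>_ y. Suc y) n" for m n :: nat
    by (induction n) auto
  moreover have "computable (\<lambda>A e. rec_nat (f A e) (\<lambda>_ y. Suc y) (g A e))"
    by (intro computable_rec_nat computable_Suc computable_var assms)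
  ultimately show ?thesis by (simp only: eq)
qed

lemma computable_mult:
  assumes "computable f" "computable g"
  shows "computable (\<lambda>A e. f A e * g A e)"
proof -
  have eq: "m * n = rec_nat 0 (\<lambda>_ y. y + m) n" for m n :: nat
    by (induction n) auto
  moreover have "computable (\<lambda>A e. rec_nat 0 (\<lambda>_ y. y + e 0) (e (Suc 0)))"
    by (intro computable_rec_nat computable_add computable_const computable_var)
  ultimately have "computable (\<lambda>A e. e 0 * e (Suc 0))" by (simp only: eq)
  from computable_app2[OF this assms] show ?thesis .
qed

lemma computable_diff:
  assumes "computable f" "computable g"
  shows "computable (\<lambda>A e. f A e - g A e)"
proof -
  have "n - Suc 0 = rec_nat 0 (\<lambda>k _. k) n" for n by (cases n) auto
  moreover have "computable (\<lambda>A e. rec_nat 0 (\<lambda>k _. k) (e 0))"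
    by (intro computable_rec_nat computable_const computable_var)
  ultimately have pred: "computable (\<lambda>A e. e 0 - Suc 0)" by (simp only:)
  have "m - n = rec_nat m (\<lambda>_ y. y - Suc 0) n" for m n by (induction n) auto
  then have "f A e - g A e = rec_nat (f A e) (\<lambda>_ y. y - Suc 0) (g A e)" for A e .
  moreover have "computable (\<lambda>A e. rec_nat (f A e) (\<lambda>_ y. y - Suc 0) (g A e))"
    by (intro computable_rec_nat assms pred)
  ultimately show ?thesis by (simp only:)
qed

lemma computable_power:
  assumes "computable f" "computable g"
  shows "computable (\<lambda>A e. f A e ^ g A e)"
proof -
  have eq: "m ^ n = rec_nat 1 (\<lambda>_ y. m * y) n" for m n :: nat
    by (induction n) auto
  moreover have "computable (\<lambda>A e. rec_nat 1 (\<lambda>_ y. e 0 * y) (e (Suc 0)))"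
    by (intro computable_rec_nat computable_mult computable_const computable_var)
  ultimately have "computable (\<lambda>A e. e 0 ^ e (Suc 0))" by (simp only: eq)
  from computable_app2[OF this assms] show ?thesis .
qed

text \<open>Bounded sums are the working loop from here on: bounded quantifiers, lengths, quotients
  and projections of pairs all become sums that count or select by truth values.\<close>

lemma computable_sum:
  assumes "computable (\<lambda>A e. f A (e 0) (\<lambda>i. e (Suc i)))" and "computable b"
  shows "computable (\<lambda>A e. \<Sum>i<b A e. f A i e)"
proof -
  have "(\<Sum>i<n. f A i e) = rec_nat 0 (\<lambda>n y. y + f A n e) n" for A e n
    by (induction n) auto
  moreover have "computable (\<lambda>A e. rec_nat 0 (\<lambda>n y. y + f A n e) (b A e))"
    by (intro computable_rec_nat computable_add computable_const computable_var assms(2)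
        computable_subst_Cons[OF assms(1)])
  ultimately show ?thesis by simp
qed

lemma computable_of_bool:
  assumes "decidable P"
  shows "computable (\<lambda>A e. of_bool (P A e))"
  using assms unfolding decidable_def .

lemma decidable_not:
  assumes "decidable P"
  shows "decidable (\<lambda>A e. \<not> P A e)"
proof -
  have "computable (\<lambda>A e. 1 - of_bool (P A e))"
    by (intro computable_diff computable_const computable_of_bool assms)
  moreover have "(1 - of_bool b :: nat) = of_bool (\<not> b)" for b by simp
  ultimately show ?thesis unfolding decidable_def by simp
qed

lemma decidable_conj:
  assumes "decidable P" "decidable Q"
  shows "decidable (\<lambda>A e. P A e \<and> Q A e)"
  using computable_mult[OF assms[THEN computable_of_bool]]
  unfolding decidable_def by (simp add: of_bool_conj)

lemma decidable_pos:
  assumes "computable f"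
  shows "decidable (\<lambda>A e. 0 < f A e)"
proof -
  have "computable (\<lambda>A e. 1 - (1 - f A e))"
    by (intro computable_diff computable_const assms)
  moreover have "1 - (1 - n) = (of_bool (0 < n) :: nat)" for n by (cases n) auto
  ultimately show ?thesis unfolding decidable_def by simp
qed

lemma decidable_less:
  assumes "computable f" "computable g"
  shows "decidable (\<lambda>A e. f A e < g A e)"
  using decidable_pos[OF computable_diff[OF assms(2,1)]] by simp

lemma decidable_le:
  assumes "computable f" "computable g"
  shows "decidable (\<lambda>A e. f A e \<le> g A e)"
  using decidable_not[OF decidable_less[OF assms(2,1)]] by (simp add: not_less)

lemma decidable_eq:
  assumes "computable f" "computable g"
  shows "decidable (\<lambda>A e. f A e = g A e)"
  using decidable_conj[OF decidable_le[OF assms] decidable_le[OF assms(2,1)]]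
  by (simp add: eq_iff)

lemma decidable_ex_less:
  assumes "decidable (\<lambda>A e. P A (e 0) (\<lambda>i. e (Suc i)))" and "computable b"
  shows "decidable (\<lambda>A e. \<exists>i<b A e. P A i e)"
proof -
  have "decidable (\<lambda>A e. 0 < (\<Sum>i<b A e. of_bool (P A i e) :: nat))"
    by (intro decidable_pos computable_sum assms computable_of_bool)
  moreover have "0 < (\<Sum>i<n. of_bool (P A i e) :: nat) \<longleftrightarrow> (\<exists>i<n. P A i e)" for A n e
    by (induction n) (auto simp: less_Suc_eq)
  ultimately show ?thesis by simp
qed

lemma decidable_all_less:
  assumes "decidable (\<lambda>A e. P A (e 0) (\<lambda>i. e (Suc i)))" and "computable b"
  shows "decidable (\<lambda>A e. \<forall>i<b A e. P A i e)"
  using decidable_not[OF decidable_ex_less[OF decidable_not[OF assms(1)] assms(2)]] by simp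

lemma computable_if:
  assumes "decidable P" "computable f" "computable g"
  shows "computable (\<lambda>A e. if P A e then f A e else g A e)"
proof -
  have "computable (\<lambda>A e. of_bool (P A e) * f A e + of_bool (\<not> P A e) * g A e)"
    by (intro computable_add computable_mult computable_of_bool decidable_not assms)
  moreover have "of_bool b * m + of_bool (\<not> b) * n = (if b then m else n)" for b and m n :: nat
    by simp
  ultimately show ?thesis by simp
qed

lemmas computable_intros =
  computable_var computable_const computable_Suc computable_add computable_mult computable_diff
  computable_power computable_sum computable_if computable_of_bool decidable_not decidable_conj
  decidable_less decidable_le decidable_eq decidable_ex_less decidable_all_less
  decidable_oracle

section \<open>Semidecidable relations and stages\<close>

lemma decidable_subst_Cons:
  assumes "decidable (\<lambda>A e. R A (e 0) (\<lambda>i. e (Suc i)))"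
    and "computable T" and "\<And>i. computable (\<lambda>A e. G A e i)"
  shows "decidable (\<lambda>A e. R A (T A e) (G A e))"
  using assms(1) unfolding decidable_def by (rule computable_subst_Cons) (rule assms(2,3))+

lemma computable_env_Cons:
  assumes "computable a" and "\<And>j. computable (\<lambda>A e. g A e j)"
  shows "computable (\<lambda>A e. case_nat (a A e) (g A e) i)"
  using assms by (cases i) auto

definition semidecidable :: "((nat \<Rightarrow> bool) \<Rightarrow> (nat \<Rightarrow> nat) \<Rightarrow> bool) \<Rightarrow> bool" where
  "semidecidable P \<longleftrightarrow>
     (\<exists>R. decidable (\<lambda>A e. R A (e 0) (\<lambda>i. e (Suc i))) \<and> (\<forall>A e. P A e \<longleftrightarrow> (\<exists>i. R A i e)))"

lemma semidecidable_if_decidable: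
  assumes "decidable P"
  shows "semidecidable P"
proof -
  have "decidable (\<lambda>A e. P A (\<lambda>i. e (Suc i)))"
    using assms unfolding decidable_def
    by (rule computable_subst) (rule computable_var)
  then show ?thesis
    unfolding semidecidable_def by (intro exI[of _ "\<lambda>A i. P A"]) simp
qed

text \<open>Dovetailing: one bound k limits both the new witness a and the old witness i, so the two
  searches merge into one without a pairing function.\<close>

lemma semidecidable_ex:
  assumes "semidecidable (\<lambda>A e. P A (e 0) (\<lambda>i. e (Suc i)))"
  shows "semidecidable (\<lambda>A e. \<exists>a. P A a e)"
proof -
  obtain R where R: "decidable (\<lambda>A e. R A (e 0) (\<lambda>i. e (Suc i)))"
    and iff: "\<And>A e. P A (e 0) (\<lambda>i. e (Suc i)) \<longleftrightarrow> (\<exists>i. R A i e)"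
    using assms unfolding semidecidable_def by blast
  have iff': "P A a e \<longleftrightarrow> (\<exists>i. R A i (case_nat a e))" for A a e
    using iff[of A "case_nat a e"] by simp
  have "decidable (\<lambda>A e. \<exists>a<e 0. \<exists>i<e 0. R A i (case_nat a (\<lambda>j. e (Suc j))))"
    by (intro computable_env_Cons computable_intros decidable_subst_Cons[OF R])
  moreover have "(\<exists>a. P A a e) \<longleftrightarrow> (\<exists>k. \<exists>a<k. \<exists>i<k. R A i (case_nat a e))" for A e
  proof
    assume "\<exists>a. P A a e"
    then obtain a i where "R A i (case_nat a e)" using iff' by blast
    then show "\<exists>k. \<exists>a<k. \<exists>i<k. R A i (case_nat a e)"
      by (intro exI[of _ "Suc (a + i)"] exI[of _ a] exI[of _ i] conjI) auto
  qed (use iff' in blast)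
  ultimately show ?thesis
    unfolding semidecidable_def
    by (intro exI[of _ "\<lambda>A k e. \<exists>a<k. \<exists>i<k. R A i (case_nat a e)"]) simp
qed

section \<open>Machines for functions and relations, and their stagewise runs\<close>

lemma recf_of_computable:
  assumes "computable (\<lambda>A e. f A (e 0) (e (Suc 0)))"
  shows "\<exists>r. \<forall>A a b. eval A r [a, b] (f A a b)"
proof -
  obtain n r where n: "n \<ge> 2" and r: "\<And>A e. eval A r (map e [0..<n]) (f A (e 0) (e (Suc 0)))"
    using assms unfolding computable_def by (meson nle_le)
  \<comment> \<open>The machine \<open>r\<close> has some arity n that may exceed 2, so the second
    argument is repeated to fill the list; \<open>f\<close> looks only at entries 0 and 1.\<close>
  have "eval A (Comp r (Proj 0 # replicate (n - 1) (Proj 1))) [a, b] (f A a b)" for A a b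
  proof -
    have "map (case_nat a (\<lambda>_. b)) [0..<n] = a # replicate (n - 1) b"
      using n by (intro nth_equalityI) (auto simp: nth_Cons split: nat.split)
    then show ?thesis
      using r[of A "case_nat a (\<lambda>_. b)"] unfolding eval_Comp_iff
      by (intro exI[of _ "a # replicate (n - 1) b"])
        (auto simp: list_all2_conv_all_nth nth_Cons eval_Proj_iff split: nat.split)
  qed
  then show ?thesis by blast
qed

text \<open>Search for the least bound k below which a value and its witness occur, then read the
  value off as a sum. Uniqueness leaves only one term of that sum to contribute.\<close>

lemma recf_of_semidecidable:
  assumes W: "semidecidable (\<lambda>A e. W A (e 0) (e (Suc 0)))"
    and unique: "\<And>A w v v'. W A w v \<Longrightarrow> W A w v' \<Longrightarrow> v = v'"
  shows "\<exists>r. \<forall>A w v. eval A r [w] v \<longleftrightarrow> W A w v"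
proof -
  obtain R0 where R0: "decidable (\<lambda>A e. R0 A (e 0) (\<lambda>i. e (Suc i)))"
    and iff0: "\<And>A e. W A (e 0) (e (Suc 0)) \<longleftrightarrow> (\<exists>i. R0 A i e)"
    using W unfolding semidecidable_def by blast
  define R where "R A i w v = R0 A i (case_nat w (\<lambda>_. v))" for A i w v
  have iff: "W A w v \<longleftrightarrow> (\<exists>i. R A i w v)" for A w v
    using iff0[of A "case_nat w (\<lambda>_. v)"] by (simp add: R_def)
  define D where "D A k w \<longleftrightarrow> (\<exists>v<k. \<exists>i<k. R A i w v)" for A k w
  define out where "out A k w = (\<Sum>v<k. v * of_bool (\<exists>i<k. R A i w v))" for A k w
  have "computable (\<lambda>A e. of_bool (\<not> D A (e 0) (e (Suc 0))))"
    unfolding D_def R_def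
    by (intro computable_env_Cons computable_intros decidable_subst_Cons[OF R0])
  then obtain rD where rD: "\<And>A k w. eval A rD [k, w] (of_bool (\<not> D A k w))"
    using recf_of_computable by meson
  have "computable (\<lambda>A e. out A (e 0) (e (Suc 0)))"
    unfolding out_def R_def
    by (intro computable_env_Cons computable_intros decidable_subst_Cons[OF R0])
  then obtain ro where ro: "\<And>A k w. eval A ro [k, w] (out A k w)"
    using recf_of_computable by meson
  have rD_iff: "eval A rD [k, w] v \<longleftrightarrow> v = of_bool (\<not> D A k w)" for A k w v
    using rD eval_deterministic by metis
  have ro_iff: "eval A ro [k, w] v \<longleftrightarrow> v = out A k w" for A k w v
    using ro eval_deterministic by metis
  have out_eq: "out A k w = v" if "D A k w" "W A w v" for A k w v
  proof -
    have v: "\<And>v' i. R A i w v' \<Longrightarrow> v' = v" using that(2) unique iff by blast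
    have "(\<exists>i<k. R A i w v) \<and> v < k" using that(1) v unfolding D_def by blast
    then have "out A k w = (\<Sum>v'<k. if v' = v then v else 0)"
      unfolding out_def by (intro sum.cong) (use v in auto)
    then show ?thesis using \<open>_ \<and> v < k\<close> by simp
  qed
  have "eval A (Comp ro [Mu rD, Proj 0]) [w] v \<longleftrightarrow>
      (\<exists>k. D A k w \<and> (\<forall>m<k. \<not> D A m w) \<and> v = out A k w)" for A w v
    by (auto simp: eval_Comp_iff eval_Mu_iff eval_Proj_iff rD_iff ro_iff list_all2_Cons1)
  moreover have "(\<exists>k. D A k w \<and> (\<forall>m<k. \<not> D A m w) \<and> v = out A k w) \<longleftrightarrow> W A w v" for A w v
  proof
    assume "W A w v"
    then obtain i where "R A i w v" using iff by blast
    then have "D A (Suc (v + i)) w" unfolding D_def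
      by (intro exI[of _ v] exI[of _ i] conjI) auto
    then obtain k where "D A k w" "\<forall>m<k. \<not> D A m w"
      using exists_least_iff[of "\<lambda>k. D A k w"] by blast
    then show "\<exists>k. D A k w \<and> (\<forall>m<k. \<not> D A m w) \<and> v = out A k w"
      using out_eq \<open>W A w v\<close> by metis
  next
    assume "\<exists>k. D A k w \<and> (\<forall>m<k. \<not> D A m w) \<and> v = out A k w"
    then obtain k where k: "D A k w" "v = out A k w" by blast
    then obtain v' where "W A w v'" unfolding D_def iff by blast
    then show "W A w v" using out_eq[OF k(1)] k(2) by simp
  qed
  ultimately show ?thesis by blast
qed

text \<open>Here m is a fixed number and \<open>P\<close> may vary with i in no uniform way. This
  serves the argument list of \<open>Comp\<close>, whose members are computed by unrelated
  machines.\<close>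

lemma decidable_all_const:
  fixes m :: nat
  assumes "\<And>i. i < m \<Longrightarrow> decidable (\<lambda>A e. P A e i)"
  shows "decidable (\<lambda>A e. \<forall>i<m. P A e i)"
  using assms
proof (induction m)
  case 0
  show ?case using decidable_eq[OF computable_const[of 0] computable_const[of 0]] by simp
next
  case (Suc m)
  have "decidable (\<lambda>A e. P A e m \<and> (\<forall>i<m. P A e i))"
    by (intro decidable_conj Suc) (use Suc.prems in auto)
  moreover have "(\<forall>i<Suc m. P A e i) \<longleftrightarrow> P A e m \<and> (\<forall>i<m. P A e i)" for A e
    by (auto simp: less_Suc_eq)
  ultimately show ?case by (simp only:)
qed

text \<open>\<open>eval\<close> has no step counter, so one is built by recursion on the program:
  \<open>F A t e\<close> is \<open>Suc v\<close> once the value v is found within budget t, and 0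
  before. Monotonicity in t lets the budgets of subcomputations be merged into one larger
  budget.\<close>

lemma stage_function_exists:
  "\<exists>F. computable (\<lambda>A e. F A (e 0) (\<lambda>i. e (Suc i)))
     \<and> (\<forall>A t t' e v. t \<le> t' \<longrightarrow> F A t e = Suc v \<longrightarrow> F A t' e = Suc v)
     \<and> (\<forall>A e v. eval A r (map e [0..<n]) v \<longleftrightarrow> (\<exists>t. F A t e = Suc v))"
proof (induction r arbitrary: n)
  case Zero
  show ?case
    by (intro exI[of _ "\<lambda>A t e. Suc 0"] conjI computable_intros) (auto simp: eval_iffs)
next
  case Succ
  show ?case
  proof (cases n)
    case 0
    then show ?thesis
      by (intro exI[of _ "\<lambda>A t e. 0"] conjI computable_intros) (auto simp: eval_iffs)
  next
    case (Suc m)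
    then show ?thesis
      by (intro exI[of _ "\<lambda>A t e. Suc (Suc (e 0))"] conjI computable_intros)
        (auto simp: eval_iffs map_upt_Suc simp del: upt_Suc)
  qed
next
  case Orc
  show ?case
  proof (cases n)
    case 0
    then show ?thesis
      by (intro exI[of _ "\<lambda>A t e. 0"] conjI computable_intros) (auto simp: eval_iffs)
  next
    case (Suc m)
    then show ?thesis
      by (intro exI[of _ "\<lambda>A t e. Suc (of_bool (A (e 0)))"] conjI computable_intros)
        (auto simp: eval_iffs map_upt_Suc simp del: upt_Suc)
  qed
next
  case (Proj i)
  show ?case
  proof (cases "i < n")
    case False
    then show ?thesis
      by (intro exI[of _ "\<lambda>A t e. 0"] conjI computable_intros) (auto simp: eval_iffs)
  next
    case True
    then show ?thesis
      by (intro exI[of _ "\<lambda>A t e. Suc (e i)"] conjI computable_intros) (auto simp: eval_iffs)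
  qed
next
  case (Comp f gs)
  define m where "m = length gs"
  obtain F where F: "computable (\<lambda>A e. F A (e 0) (\<lambda>i. e (Suc i)))"
    and F_mono: "\<And>A t t' e v. t \<le> t' \<Longrightarrow> F A t e = Suc v \<Longrightarrow> F A t' e = Suc v"
    and F_iff: "\<And>A e v. eval A f (map e [0..<m]) v \<longleftrightarrow> (\<exists>t. F A t e = Suc v)"
    using Comp.IH(1)[of m] by blast
  define Q where "Q i G \<longleftrightarrow> computable (\<lambda>A e. G A (e 0) (\<lambda>i. e (Suc i)))
     \<and> (\<forall>A t t' e v. t \<le> t' \<longrightarrow> G A t e = Suc v \<longrightarrow> G A t' e = Suc v)
     \<and> (\<forall>A e v. i < m \<longrightarrow> eval A (gs ! i) (map e [0..<n]) v \<longleftrightarrow> (\<exists>t. G A t e = Suc v))" for i G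
  have "\<exists>G. Q i G" for i
  proof (cases "i < m")
    case True
    then show ?thesis using Comp.IH(2)[of "gs ! i" n] by (simp add: m_def Q_def)
  next
    case False
    then show ?thesis
      unfolding Q_def by (intro exI[of _ "\<lambda>A t e. 0"] conjI computable_intros) auto
  qed
  then obtain G where Q: "\<And>i. Q i (G i)" by metis
  have G: "computable (\<lambda>A e. G i A (e 0) (\<lambda>i. e (Suc i)))"
    and G_mono: "t \<le> t' \<Longrightarrow> G i A t e = Suc v \<Longrightarrow> G i A t' e = Suc v"
    and G_iff: "i < m \<Longrightarrow> eval A (gs ! i) (map e [0..<n]) v \<longleftrightarrow> (\<exists>t. G i A t e = Suc v)"
    for i A t t' e v
    using Q[of i] unfolding Q_def by blast+
  \<comment> \<open>Entries from m on are set to 0, so that environments agreeing on the m arguments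
    are equal as functions.\<close>
  define E where "E A t e i = (if i < m then G i A t e - 1 else 0)" for A t e i
  define H where "H A t e = (if \<forall>i<m. 0 < G i A t e then F A t (E A t e) else 0)" for A t e
  have E: "computable (\<lambda>A e. E A (e 0) (\<lambda>i. e (Suc i)) i)" for i
    unfolding E_def by (intro computable_if decidable_less computable_diff computable_const G)
  have E_mono: "(\<forall>i<m. 0 < G i A t' e) \<and> E A t' e = E A t e"
    if "t \<le> t'" "\<forall>i<m. 0 < G i A t e" for A t t' e
  proof -
    have "G i A t' e = G i A t e" if i: "i < m" for i
    proof -
      obtain w where w: "G i A t e = Suc w"
        using i \<open>\<forall>i<m. 0 < G i A t e\<close> by (cases "G i A t e") auto
      show ?thesis using G_mono[OF \<open>t \<le> t'\<close> w] w by simp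
    qed
    then show ?thesis using that(2) by (simp add: E_def fun_eq_iff)
  qed
  show ?case
  proof (intro exI[of _ H] conjI allI impI)
    show "computable (\<lambda>A e. H A (e 0) (\<lambda>i. e (Suc i)))"
      unfolding H_def
      by (intro computable_if decidable_all_const decidable_less computable_const G
          computable_subst_Cons[OF F] computable_var E)
  next
    fix A t t' e v assume *: "t \<le> t'" "H A t e = Suc v"
    then show "H A t' e = Suc v"
      using E_mono[of t t' A e] F_mono[of t t' A] by (auto simp: H_def split: if_splits)
  next
    show "eval A (Comp f gs) (map e [0..<n]) v \<longleftrightarrow> (\<exists>t. H A t e = Suc v)" for A e v
    proof
      assume "eval A (Comp f gs) (map e [0..<n]) v"
      then obtain ys where len: "length ys = m" and f: "eval A f ys v"
        and "\<And>i. i < m \<Longrightarrow> eval A (gs ! i) (map e [0..<n]) (ys ! i)"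
        by (auto simp: eval_Comp_iff list_all2_conv_all_nth m_def)
      then have "\<forall>i. \<exists>t. i < m \<longrightarrow> G i A t e = Suc (ys ! i)" using G_iff by metis
      then obtain \<tau> where \<tau>: "\<And>i. i < m \<Longrightarrow> G i A (\<tau> i) e = Suc (ys ! i)" by metis
      define ye where "ye i = (if i < m then ys ! i else 0)" for i
      have "map ye [0..<m] = ys" using len by (intro nth_equalityI) (auto simp: ye_def)
      then obtain s where s: "F A s ye = Suc v" using f F_iff by metis
      define t where "t = s + sum \<tau> {..<m}"
      have G_t: "G i A t e = Suc (ys ! i)" if "i < m" for i
      proof (rule G_mono[OF _ \<tau>[OF that]])
        show "\<tau> i \<le> t" using that member_le_sum[of i "{..<m}" \<tau>] by (simp add: t_def)
      qed
      then have "E A t e = ye" by (auto simp: E_def ye_def)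
      moreover have "F A t ye = Suc v" using F_mono[OF _ s] by (simp add: t_def)
      ultimately have "H A t e = Suc v" using G_t by (simp add: H_def)
      then show "\<exists>t. H A t e = Suc v" by blast
    next
      assume "\<exists>t. H A t e = Suc v"
      then obtain t where pos: "\<And>i. i < m \<Longrightarrow> 0 < G i A t e" and F_t: "F A t (E A t e) = Suc v"
        by (auto simp: H_def split: if_splits)
      have "eval A (gs ! i) (map e [0..<n]) (E A t e i)" if "i < m" for i
        using that pos[OF that] G_iff[OF that] by (auto simp: E_def gr0_conv_Suc)
      moreover have "eval A f (map (E A t e) [0..<m]) v" using F_t F_iff by blast
      ultimately show "eval A (Comp f gs) (map e [0..<n]) v"
        unfolding eval_Comp_iff
        by (intro exI[of _ "map (E A t e) [0..<m]"]) (auto simp: list_all2_conv_all_nth m_def)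
    qed
  qed
next
  case (Prec f g)
  show ?case
  proof (cases n)
    case 0
    then show ?thesis
      by (intro exI[of _ "\<lambda>A t e. 0"] conjI computable_intros) (auto simp: eval_iffs)
  next
    case (Suc m)
    obtain F where F: "computable (\<lambda>A e. F A (e 0) (\<lambda>i. e (Suc i)))"
      and F_mono: "\<And>A t t' e v. t \<le> t' \<Longrightarrow> F A t e = Suc v \<Longrightarrow> F A t' e = Suc v"
      and F_iff: "\<And>A e v. eval A f (map e [0..<m]) v \<longleftrightarrow> (\<exists>t. F A t e = Suc v)"
      using Prec.IH(1)[of m] by blast
    obtain G where G: "computable (\<lambda>A e. G A (e 0) (\<lambda>i. e (Suc i)))"
      and G_mono: "\<And>A t t' e v. t \<le> t' \<Longrightarrow> G A t e = Suc v \<Longrightarrow> G A t' e = Suc v"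
      and G_iff: "\<And>A e v. eval A g (map e [0..<Suc (Suc m)]) v \<longleftrightarrow> (\<exists>t. G A t e = Suc v)"
      using Prec.IH(2)[of "Suc (Suc m)"] by blast
    have G_iff': "eval A g (y # k # map e [0..<m]) v \<longleftrightarrow>
        (\<exists>t. G A t (case_nat y (case_nat k e)) = Suc v)" for A y k e v
      using G_iff[of A "case_nat y (case_nat k e)" v] by (simp add: map_upt_Suc del: upt_Suc)
    \<comment> \<open>The 0 propagates: while the previous value is unknown, so is the next
      one.\<close>
    define H where "H A t k e = rec_nat (F A t e)
      (\<lambda>k y. if y = 0 then 0 else G A t (case_nat (y - 1) (case_nat k e))) k" for A t k e
    have H_mono: "H A t k e = Suc v \<Longrightarrow> t \<le> t' \<Longrightarrow> H A t' k e = Suc v" for A t t' k e v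
    proof (induction k arbitrary: v)
      case 0
      then show ?case using F_mono by (simp add: H_def)
    next
      case (Suc k)
      then show ?case using G_mono
        by (cases "H A t k e") (auto simp: H_def)
    qed
    have H_iff: "eval A (Prec f g) (k # map e [0..<m]) v \<longleftrightarrow> (\<exists>t. H A t k e = Suc v)" for A k e v
    proof (induction k arbitrary: v)
      case 0
      show ?case by (simp add: eval_Prec_0_iff F_iff H_def)
    next
      case (Suc k)
      show ?case
      proof
        assume "eval A (Prec f g) (Suc k # map e [0..<m]) v"
        then obtain y t s where "H A t k e = Suc y" "G A s (case_nat y (case_nat k e)) = Suc v"
          using Suc.IH by (auto simp: eval_Prec_Suc_iff G_iff')
        then have "H A (t + s) k e = Suc y" "G A (t + s) (case_nat y (case_nat k e)) = Suc v"
          using H_mono G_mono by (meson le_add1, meson le_add2)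
        then show "\<exists>t. H A t (Suc k) e = Suc v"
          by (intro exI[of _ "t + s"]) (simp add: H_def)
      next
        assume "\<exists>t. H A t (Suc k) e = Suc v"
        then obtain t where t: "H A t (Suc k) e = Suc v" by blast
        then obtain y where "H A t k e = Suc y" by (cases "H A t k e") (auto simp: H_def)
        moreover from this have "G A t (case_nat y (case_nat k e)) = Suc v"
          using t by (simp add: H_def)
        ultimately show "eval A (Prec f g) (Suc k # map e [0..<m]) v"
          using Suc.IH by (auto simp: eval_Prec_Suc_iff G_iff')
      qed
    qed
    show ?thesis
    proof (intro exI[of _ "\<lambda>A t e. H A t (e 0) (\<lambda>i. e (Suc i))"] conjI allI impI)
      show "computable (\<lambda>A e. H A (e 0) (e (Suc 0)) (\<lambda>i. e (Suc (Suc i))))"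
        unfolding H_def
        by (intro computable_rec_nat computable_intros
            computable_subst_Cons[OF F] computable_subst_Cons[OF G] computable_env_Cons)
    next
      show "H A t' (e 0) (\<lambda>i. e (Suc i)) = Suc v"
        if "t \<le> t'" "H A t (e 0) (\<lambda>i. e (Suc i)) = Suc v" for A t t' e v
        using that H_mono by blast
    next
      show "eval A (Prec f g) (map e [0..<n]) v \<longleftrightarrow> (\<exists>t. H A t (e 0) (\<lambda>i. e (Suc i)) = Suc v)"
        for A e v
        using H_iff[of A "e 0" "\<lambda>i. e (Suc i)" v] by (simp add: Suc map_upt_Suc del: upt_Suc)
    qed
  qed
next
  case (Mu f)
  obtain F where F: "computable (\<lambda>A e. F A (e 0) (\<lambda>i. e (Suc i)))"
    and F_mono: "\<And>A t t' e v. t \<le> t' \<Longrightarrow> F A t e = Suc v \<Longrightarrow> F A t' e = Suc v"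
    and F_iff: "\<And>A e v. eval A f (map e [0..<Suc n]) v \<longleftrightarrow> (\<exists>t. F A t e = Suc v)"
    using Mu.IH[of "Suc n"] by blast
  have F_iff': "eval A f (k # map e [0..<n]) v \<longleftrightarrow> (\<exists>t. F A t (case_nat k e) = Suc v)" for A k e v
    using F_iff[of A "case_nat k e" v] by (simp add: map_upt_Suc del: upt_Suc)
  \<comment> \<open>\<open>F = 1\<close> stores the value 0 and \<open>1 < F\<close> a known
    positive value; an earlier argument without a value yet keeps \<open>F\<close> at 0 and blocks
    the search, as in the rule for \<open>Mu\<close>.\<close>
  define C where "C A t k e \<longleftrightarrow>
    F A t (case_nat k e) = 1 \<and> (\<forall>j<k. 1 < F A t (case_nat j e))" for A t k e
  define H where "H A t e = (\<Sum>k<t. of_bool (C A t k e) * Suc k)" for A t e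
  have C_unique: "k = k'" if "C A t k e" "C A t k' e" for A t k k' e
    using that unfolding C_def by (metis less_irrefl linorder_neqE_nat)
  have C_mono: "C A t' k e" if "C A t k e" "t \<le> t'" for A t t' k e
  proof -
    have "F A t' (case_nat j e) = F A t (case_nat j e)" if pos: "0 < F A t (case_nat j e)" for j
    proof -
      obtain w where w: "F A t (case_nat j e) = Suc w"
        using pos by (cases "F A t (case_nat j e)") auto
      show ?thesis using F_mono[OF \<open>t \<le> t'\<close> w] w by simp
    qed
    then show ?thesis using \<open>C A t k e\<close> by (auto simp: C_def)
  qed
  have H_eq: "H A t e = Suc k \<longleftrightarrow> k < t \<and> C A t k e" for A t k e
  proof
    assume *: "k < t \<and> C A t k e"
    then have "H A t e = (\<Sum>k'<t. if k' = k then Suc k else 0)"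
      unfolding H_def by (intro sum.cong) (auto dest: C_unique)
    then show "H A t e = Suc k" using * by simp
  next
    assume *: "H A t e = Suc k"
    then obtain k' where k': "k' < t" "C A t k' e"
      unfolding H_def by (metis (no_types, lifting) lessThan_iff mult_is_0 nat.distinct(1) of_bool_eq_0_iff sum.neutral)
    then have "H A t e = (\<Sum>k''<t. if k'' = k' then Suc k' else 0)"
      unfolding H_def by (intro sum.cong) (auto dest: C_unique)
    then show "k < t \<and> C A t k e" using * k' by simp
  qed
  show ?case
  proof (intro exI[of _ H] conjI allI impI)
    show "computable (\<lambda>A e. H A (e 0) (\<lambda>i. e (Suc i)))"
      unfolding H_def C_def
      by (intro computable_env_Cons computable_intros computable_subst_Cons[OF F])
  next
    show "H A t' e = Suc v" if "t \<le> t'" "H A t e = Suc v" for A t t' e v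
      using that C_mono by (auto simp: H_eq)
  next
    show "eval A (Mu f) (map e [0..<n]) v \<longleftrightarrow> (\<exists>t. H A t e = Suc v)" for A e v
    proof
      assume "eval A (Mu f) (map e [0..<n]) v"
      then obtain s where s: "F A s (case_nat v e) = 1"
        and "\<forall>m<v. \<exists>y t. 0 < y \<and> F A t (case_nat m e) = Suc y"
        by (fastforce simp: eval_Mu_iff F_iff')
      then obtain y \<tau> where y: "\<And>m. m < v \<Longrightarrow> 0 < y m"
        and \<tau>: "\<And>m. m < v \<Longrightarrow> F A (\<tau> m) (case_nat m e) = Suc (y m)" by metis
      define t where "t = s + sum \<tau> {..<v} + Suc v"
      have "F A t (case_nat m e) = Suc (y m)" if "m < v" for m
      proof (rule F_mono[OF _ \<tau>[OF that]])
        show "\<tau> m \<le> t" using that member_le_sum[of m "{..<v}" \<tau>] by (simp add: t_def)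
      qed
      moreover have "F A t (case_nat v e) = Suc 0"
        using F_mono[of s t A "case_nat v e" 0] s by (simp add: t_def)
      ultimately have "C A t v e" using y by (simp add: C_def)
      then have "H A t e = Suc v" by (simp add: H_eq t_def)
      then show "\<exists>t. H A t e = Suc v" by blast
    next
      assume "\<exists>t. H A t e = Suc v"
      then obtain t where t: "F A t (case_nat v e) = Suc 0" "\<And>m. m < v \<Longrightarrow> 1 < F A t (case_nat m e)"
        by (auto simp: H_eq C_def)
      have "\<exists>y>0. eval A f (m # map e [0..<n]) y" if "m < v" for m
        using t(2)[OF that] F_iff'
        by (intro exI[of _ "F A t (case_nat m e) - 1"] conjI) (auto intro!: exI[of _ t])
      then show "eval A (Mu f) (map e [0..<n]) v"
        using t(1) F_iff' by (auto simp: eval_Mu_iff)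
    qed
  qed
qed

section \<open>Numbering strings and pairs\<close>

lemma enc_Nil [simp]: "enc [] = 0"
  by (simp add: enc_def)

lemma enc_snoc [simp]: "enc (s @ [b]) = 2 * enc s + (if b then 2 else 1)"
  by (simp add: enc_def)

text \<open>Machines act on numbers, so cutting an input into two strings has to be arithmetic:
  decoders below solve \<open>w = p * 2 ^ len q + q\<close>.\<close>

lemma enc_append: "enc (s @ t) = enc s * 2 ^ length t + enc t"
proof (induction t rule: rev_induct)
  case (snoc b t)
  then show ?case by (simp flip: append_assoc add: algebra_simps)
qed simp

lemma enc_lower: "2 ^ length s \<le> Suc (enc s)"
  by (induction s rule: rev_induct) auto

lemma enc_upper: "Suc (enc s) < 2 ^ Suc (length s)"
  by (induction s rule: rev_induct) auto

lemma inj_enc: "enc s = enc t \<longleftrightarrow> s = t"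
proof
  show "enc s = enc t \<Longrightarrow> s = t"
  proof (induction s arbitrary: t rule: rev_induct)
    case Nil
    then show ?case by (cases t rule: rev_cases) (auto split: if_splits)
  next
    case (snoc b s)
    show ?case
    proof (cases t rule: rev_cases)
      case Nil
      then show ?thesis using snoc.prems by (auto split: if_splits)
    next
      case (snoc t' b')
      have "2 * enc s + (if b then 2 else 1) = 2 * enc t' + (if b' then 2 else 1)"
        using snoc.prems \<open>t = _\<close> by simp
      then have "b = b' \<and> enc s = enc t'" by (simp split: if_splits) presburger+
      then show ?thesis using snoc.IH \<open>t = _\<close> by blast
    qed
  qed
qed simp

lemma enc_surj: "\<exists>s. enc s = n"
proof (induction n rule: less_induct)
  case (less n)
  show ?case
  proof (cases "n = 0")
    case False
    then obtain s where s: "enc s = (n - 1) div 2" using less by fastforce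
    have "enc (s @ [even n]) = n" using False s by (auto elim!: evenE oddE)
    then show ?thesis by blast
  qed (use enc_Nil in blast)
qed

definition dec :: "nat \<Rightarrow> str" where
  "dec n = (THE s. enc s = n)"

lemma dec_enc [simp]: "dec (enc s) = s"
  by (simp add: dec_def inj_enc)

lemma enc_dec [simp]: "enc (dec n) = n"
  using enc_surj[of n] by auto

lemma phi_eq_Some_iff: "phi A r p = Some x \<longleftrightarrow> eval A r [enc p] (enc x)"
proof -
  have "(THE y. eval A r [enc p] (enc y)) = x" if "eval A r [enc p] (enc x)" for x
    using that by (intro the_equality) (auto simp: inj_enc dest: eval_deterministic)
  then show ?thesis unfolding phi_def by (auto split: if_splits)
qed

text \<open>\<open>Suc n\<close> lies between two consecutive powers of 2, the lower of which has
  the length as its exponent; so this is the integer part of log2 (n+1), counted by a sum.\<close>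

definition len :: "nat \<Rightarrow> nat" where
  "len n = (\<Sum>l<n. of_bool (2 ^ Suc l \<le> Suc n))"

lemma computable_len:
  assumes "computable f"
  shows "computable (\<lambda>A e. len (f A e))"
proof -
  have "computable (\<lambda>A e. len (e 0))"
    unfolding len_def by (intro computable_intros)
  from computable_app1[OF this assms] show ?thesis .
qed

lemma len_enc [simp]: "len (enc s) = length s"
proof -
  have "{l. l < enc s \<and> 2 ^ Suc l \<le> Suc (enc s)} = {..<length s}"
  proof (intro set_eqI iffI)
    fix l assume "l \<in> {l. l < enc s \<and> 2 ^ Suc l \<le> Suc (enc s)}"
    then have "2 ^ Suc l \<le> Suc (enc s)" by blast
    then have "2 ^ Suc l < (2::nat) ^ Suc (length s)" using enc_upper[of s] by linarith
    then have "Suc l < Suc (length s)" by (rule power_less_imp_less_exp[rotated]) simp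
    then show "l \<in> {..<length s}" by simp
  next
    fix l assume "l \<in> {..<length s}"
    then have "(2::nat) ^ Suc l \<le> 2 ^ length s" by (intro power_increasing) auto
    then have "2 ^ Suc l \<le> Suc (enc s)" using enc_lower[of s] by simp
    moreover have "Suc l < 2 ^ Suc l" by (rule less_exp)
    ultimately show "l \<in> {l. l < enc s \<and> 2 ^ Suc l \<le> Suc (enc s)}" by simp
  qed
  moreover have "len (enc s) = card {l. l < enc s \<and> 2 ^ Suc l \<le> Suc (enc s)}"
    unfolding len_def by (simp add: sum.If_cases lessThan_def Int_def of_bool_def)
  ultimately show ?thesis by simp
qed

lemma len_le: "len n \<le> n"
proof -
  have "len n \<le> (\<Sum>l<n. 1)" unfolding len_def by (intro sum_mono) auto
  then show ?thesis by simp
qed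

text \<open>\<open>Suc (enc s)\<close> has the binary digits 1s. Dropping the leading 1 leaves the
  ordinary binary value, so that s stands for the dyadic interval from
  \<open>bval s / 2 ^ length s\<close> to \<open>(bval s + 1) / 2 ^ length s\<close>.\<close>

definition bval :: "str \<Rightarrow> nat" where
  "bval s = Suc (enc s) - 2 ^ length s"

lemma Suc_enc_eq: "Suc (enc s) = 2 ^ length s + bval s"
  using enc_lower[of s] by (simp add: bval_def)

lemma bval_less: "bval s < 2 ^ length s"
  using enc_upper[of s] enc_lower[of s] by (simp add: bval_def)

lemma bval_append: "bval (s @ t) = bval s * 2 ^ length t + bval t"
proof -
  have "2 ^ length (s @ t) + bval (s @ t) = Suc (enc s) * 2 ^ length t + enc t + 1 - 2 ^ length t"
    unfolding Suc_enc_eq[symmetric] enc_append by simp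
  also have "\<dots> = Suc (enc s) * 2 ^ length t + bval t"
    using enc_lower[of t] by (simp add: bval_def)
  also have "\<dots> = 2 ^ length (s @ t) + (bval s * 2 ^ length t + bval t)"
    by (simp add: Suc_enc_eq power_add algebra_simps del: add_Suc)
  finally show ?thesis by simp
qed

lemma bval_replicate_False [simp]: "bval (replicate k False) = 0"
proof (induction k)
  case 0
  show ?case by (simp add: bval_def)
next
  case (Suc k)
  have "bval [False] = 0" by (simp add: bval_def enc_def)
  then show ?case using Suc bval_append[of "replicate k False" "[False]"]
    by (simp add: replicate_append_same)
qed

lemma ex_bval:
  assumes "v < 2 ^ n"
  shows "\<exists>s. length s = n \<and> bval s = v"
proof -
  define s where "s = dec (2 ^ n + v - 1)"
  have s: "Suc (enc s) = 2 ^ n + v" by (simp add: s_def)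
  have "(2::nat) ^ n < 2 ^ Suc (length s)" using enc_upper[of s] s by linarith
  moreover have "(2::nat) ^ length s < 2 ^ Suc n" using enc_lower[of s] s assms by simp
  ultimately have "length s = n"
    using power_less_imp_less_exp[of "2::nat"] by (meson le_antisym less_Suc_eq_le one_less_numeral_iff semiring_norm(76))
  then show ?thesis using s by (auto simp: bval_def)
qed

section \<open>Division and the arithmetic of the string pairing\<close>

lemma computable_div:
  assumes "computable f" "computable g"
  shows "computable (\<lambda>A e. f A e div g A e)"
proof -
  \<comment> \<open>For d = 0 the sum would count every k < m, whereas \<open>m div 0\<close> is
    0.\<close>
  have eq: "m div d = (if d = 0 then 0 else \<Sum>k<m. of_bool (Suc k * d \<le> m))" for m d :: nat
  proof (cases "d = 0")
    case False
    have "{k. k < m \<and> Suc k * d \<le> m} = {..<m div d}"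
    proof (intro set_eqI)
      fix k
      have "Suc k * d \<le> m \<longleftrightarrow> k < m div d"
        using False less_eq_div_iff_mult_less_eq[of d "Suc k" m] by (simp add: Suc_le_eq)
      moreover have "k < m div d \<Longrightarrow> k < m"
        using div_le_dividend[of m d] by (rule less_le_trans[rotated])
      ultimately show "k \<in> {k. k < m \<and> Suc k * d \<le> m} \<longleftrightarrow> k \<in> {..<m div d}" by auto
    qed
    moreover have "(\<Sum>k<m. of_bool (Suc k * d \<le> m)) = card {k. k < m \<and> Suc k * d \<le> m}"
      by (simp add: sum.If_cases lessThan_def Int_def of_bool_def)
    ultimately show ?thesis using False by simp
  qed simp
  have "computable (\<lambda>A e. if e (Suc 0) = 0 then 0 else \<Sum>k<e 0. of_bool (Suc k * e (Suc 0) \<le> e 0))"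
    by (intro computable_intros)
  then have "computable (\<lambda>A e. e 0 div e (Suc 0))" unfolding eq .
  from computable_app2[OF this assms] show ?thesis .
qed

lemma computable_mod:
  assumes "computable f" "computable g"
  shows "computable (\<lambda>A e. f A e mod g A e)"
  using computable_diff[OF assms(1) computable_mult[OF computable_div[OF assms] assms(2)]]
  by (simp add: minus_div_mult_eq_mod)

text \<open>Each bit c of the string, a binary digit of \<open>Suc n\<close> below the leading 1,
  contributes the block cc, whose number is \<open>3 * (1 + c)\<close>; appending two bits
  multiplies by 4.\<close>

definition dbl :: "nat \<Rightarrow> nat" where
  "dbl n = (\<Sum>i<len n. 3 * (1 + (Suc n div 2 ^ i) mod 2) * 4 ^ i)"

lemma enc_double: "enc (concat (map (\<lambda>b. [b, b]) x)) = dbl (enc x)"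
proof (induction x rule: rev_induct)
  case Nil
  show ?case by (simp add: dbl_def len_def)
next
  case (snoc b x)
  define c where "c = (if b then 1 else 0 :: nat)"
  have suc: "Suc (enc (x @ [b])) = 2 * Suc (enc x) + c" by (simp add: c_def)
  have "dbl (enc (x @ [b])) =
      3 * (1 + c) + (\<Sum>i<length x. 3 * (1 + (Suc (enc (x @ [b])) div 2 ^ Suc i) mod 2) * 4 ^ Suc i)"
    unfolding dbl_def len_enc suc length_append_singleton
    by (subst sum.lessThan_Suc_shift) (simp add: c_def)
  also have "(\<lambda>i. Suc (enc (x @ [b])) div 2 ^ Suc i) = (\<lambda>i. Suc (enc x) div 2 ^ i)"
    unfolding suc by (intro ext) (simp add: div_mult2_eq c_def)
  also have "3 * (1 + c) + (\<Sum>i<length x. 3 * (1 + (Suc (enc x) div 2 ^ i) mod 2) * 4 ^ Suc i)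
      = 3 * (1 + c) + 4 * dbl (enc x)"
    by (simp add: dbl_def sum_distrib_left mult.left_commute)
  finally have "dbl (enc (x @ [b])) = 3 * (1 + c) + 4 * dbl (enc x)" .
  moreover have "enc [b, b] = 3 * (1 + c)" by (simp add: enc_def c_def)
  ultimately show ?case using snoc by (simp add: enc_append del: enc_snoc)
qed

text \<open>This is \<open>pair_str\<close> carried out on numbers; 4 is the number of the separator
  01.\<close>

definition npair :: "nat \<Rightarrow> nat \<Rightarrow> nat" where
  "npair a b = dbl a * 2 ^ (len b + 2) + 4 * 2 ^ len b + b"

lemma enc_pair_str: "enc (pair_str x y) = npair (enc x) (enc y)"
proof -
  have "enc [False, True] = 4" by (simp add: enc_def)
  then show ?thesis
    unfolding pair_str_def npair_def enc_append enc_double by simp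
qed

lemma computable_npair:
  assumes "computable f" "computable g"
  shows "computable (\<lambda>A e. npair (f A e) (g A e))"
proof -
  have "computable (\<lambda>A e. npair (e 0) (e (Suc 0)))"
    unfolding npair_def dbl_def
    by (intro computable_intros computable_len computable_div computable_mod)
  from computable_app2[OF this assms] show ?thesis .
qed

lemma pair_str_inject: "pair_str x y = pair_str x' y' \<longleftrightarrow> x = x' \<and> y = y'"
proof
  show "pair_str x y = pair_str x' y' \<Longrightarrow> x = x' \<and> y = y'"
  proof (induction x arbitrary: x')
    case Nil
    then show ?case by (cases x') (auto simp: pair_str_def)
  next
    case (Cons b x)
    then show ?case by (cases x') (auto simp: pair_str_def)
  qed
qed simp

lemma npair_inject: "npair a b = npair a' b' \<longleftrightarrow> a = a' \<and> b = b'"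
  using pair_str_inject[of "dec a" "dec b" "dec a'" "dec b'"]
  by (metis enc_dec enc_pair_str dec_enc)

lemma less_npair: "b < npair a b"
  by (simp add: npair_def)

text \<open>The words 1^n 0 are prefix-free and their numbers have a closed form, so a machine can
  take a number as self-delimiting input by arithmetic alone.\<close>

lemma enc_unary: "enc (replicate n True @ [False]) = 2 ^ (n + 2) - 3"
proof -
  have "enc (replicate n True) = 2 ^ Suc n - 2"
  proof (induction n)
    case (Suc n)
    have "(1::nat) \<le> 2 ^ n" by simp
    then have "2 * (2 ^ Suc n - 2) + 2 = (2::nat) ^ Suc (Suc n) - 2"
      unfolding power_Suc by linarith
    then show ?case using Suc enc_snoc[of "replicate n True" True]
      by (simp add: replicate_append_same)
  qed simp
  moreover have "2 * (2 ^ Suc n - 2) + 1 = (2::nat) ^ (n + 2) - 3"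
  proof -
    have "(1::nat) \<le> 2 ^ n" by simp
    moreover have "(2::nat) ^ (n + 2) = 4 * 2 ^ n" by simp
    ultimately show ?thesis unfolding power_Suc by linarith
  qed
  ultimately show ?thesis by (simp only: enc_snoc if_False)
qed

section \<open>Pairing for the indices of requests\<close>

lemma computable_prod_encode:
  assumes "computable f" "computable g"
  shows "computable (\<lambda>A e. prod_encode (f A e, g A e))"
proof -
  have "triangle k = (\<Sum>i<Suc k. i)" for k by (induction k) simp_all
  then have eq: "prod_encode (m, n) = (\<Sum>i<Suc (m + n). i) + m" for m n
    by (simp add: prod_encode_def)
  have "computable (\<lambda>A e. prod_encode (e 0, e (Suc 0)))"
    unfolding eq by (intro computable_intros)
  from computable_app2[OF this assms] show ?thesis .
qed

text \<open>\<open>npair\<close> reaches only the numbers of strings of the form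
  \<open>pair_str\<close>. Requests are indexed by a bijection instead, so that every number is a
  request and bounds its own components.\<close>

definition pfst :: "nat \<Rightarrow> nat" where "pfst n = fst (prod_decode n)"
definition psnd :: "nat \<Rightarrow> nat" where "psnd n = snd (prod_decode n)"

lemma pfst_prod_encode [simp]: "pfst (prod_encode (a, b)) = a"
  and psnd_prod_encode [simp]: "psnd (prod_encode (a, b)) = b"
  and prod_encode_pfst_psnd [simp]: "prod_encode (pfst n, psnd n) = n"
  by (simp_all add: pfst_def psnd_def)

lemma pfst_le: "pfst n \<le> n" and psnd_le: "psnd n \<le> n"
  by (metis le_prod_encode_1 le_prod_encode_2 prod_encode_pfst_psnd)+

lemma computable_pfst:
  assumes "computable f"
  shows "computable (\<lambda>A e. pfst (f A e))"
proof -
  have eq: "pfst n = (\<Sum>a<Suc n. a * of_bool (\<exists>b<Suc n. prod_encode (a, b) = n))" for n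
  proof -
    have "(\<exists>b<Suc n. prod_encode (a, b) = n) \<longleftrightarrow> a = pfst n" for a
      using psnd_le[of n] by (auto intro!: exI[of _ "psnd n"])
    then have "(\<Sum>a<Suc n. a * of_bool (\<exists>b<Suc n. prod_encode (a, b) = n))
        = (\<Sum>a<Suc n. if a = pfst n then pfst n else 0)"
      by (intro sum.cong) auto
    then show ?thesis using pfst_le[of n] by (simp del: sum.lessThan_Suc)
  qed
  have "computable (\<lambda>A e. pfst (e 0))"
    unfolding eq by (intro computable_intros computable_prod_encode)
  from computable_app1[OF this assms] show ?thesis .
qed

lemma computable_psnd:
  assumes "computable f"
  shows "computable (\<lambda>A e. psnd (f A e))"
proof -
  have eq: "psnd n = (\<Sum>b<Suc n. b * of_bool (\<exists>a<Suc n. prod_encode (a, b) = n))" for n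
  proof -
    have "(\<exists>a<Suc n. prod_encode (a, b) = n) \<longleftrightarrow> b = psnd n" for b
      using pfst_le[of n] by (auto intro!: exI[of _ "pfst n"])
    then have "(\<Sum>b<Suc n. b * of_bool (\<exists>a<Suc n. prod_encode (a, b) = n))
        = (\<Sum>b<Suc n. if b = psnd n then psnd n else 0)"
      by (intro sum.cong) auto
    then show ?thesis using psnd_le[of n] by (simp del: sum.lessThan_Suc)
  qed
  have "computable (\<lambda>A e. psnd (e 0))"
    unfolding eq by (intro computable_intros computable_prod_encode)
  from computable_app1[OF this assms] show ?thesis .
qed

text \<open>Extend every word to the common length N: a word of length l has
  \<open>2 ^ (N - l)\<close> extensions, and no extension is shared, since two prefixes of one word
  are comparable.\<close>

lemma kraft_inequality:
  assumes "finite S" "prefix_free S"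
  shows "(\<Sum>p\<in>S. (1/2) ^ length p) \<le> (1::real)"
proof -
  define N where "N = Max (insert 0 (length ` S))"
  have N: "length p \<le> N" if "p \<in> S" for p
    using that assms(1) by (simp add: N_def)
  define ext where "ext p = {w :: str. length w = N \<and> prefix p w}" for p
  have "ext p = (@) p ` {t. length t = N - length p}" if "p \<in> S" for p
    using N[OF that] by (auto simp: ext_def prefix_def image_iff)
  then have card: "card (ext p) = 2 ^ (N - length p)" if "p \<in> S" for p
    using that card_lists_length_eq[of "UNIV :: bool set" "N - length p"]
    by (simp add: card_image inj_on_def)
  have fin: "finite {w :: str. length w = N}"
    using finite_lists_length_eq[of "UNIV :: bool set" N] by simp
  have "(\<Sum>p\<in>S. card (ext p)) = card (\<Union> (ext ` S))"
  proof (rule card_UN_disjoint[symmetric])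
    show "\<forall>p\<in>S. finite (ext p)" using fin by (auto simp: ext_def intro: finite_subset)
    show "\<forall>p\<in>S. \<forall>q\<in>S. p \<noteq> q \<longrightarrow> ext p \<inter> ext q = {}"
    proof (intro ballI impI)
      fix p q assume "p \<in> S" "q \<in> S" "p \<noteq> q"
      then have "\<not> prefix p q" "\<not> prefix q p"
        using assms(2) unfolding prefix_free_def by blast+
      then show "ext p \<inter> ext q = {}"
        unfolding ext_def using prefix_same_cases[of p _ q] by blast
    qed
  qed (rule assms(1))
  also have "\<dots> \<le> card {w :: str. length w = N}"
    using fin by (intro card_mono) (auto simp: ext_def)
  also have "\<dots> = 2 ^ N" using card_lists_length_eq[of "UNIV :: bool set" N] by simp
  finally have "(\<Sum>p\<in>S. 2 ^ (N - length p)) \<le> (2::nat) ^ N" using card by simp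
  then have "real (\<Sum>p\<in>S. 2 ^ (N - length p)) \<le> real (2 ^ N)" by (simp only: of_nat_le_iff)
  moreover have "real (2 ^ (N - length p)) = 2 ^ N * (1/2) ^ length p" if "p \<in> S" for p
    using N[OF that] power_diff[of "2::real" "length p" N] by (simp add: power_divide)
  ultimately have "2 ^ N * (\<Sum>p\<in>S. (1/2) ^ length p) \<le> (2::real) ^ N * 1"
    by (simp add: sum_distrib_left)
  then show ?thesis by (subst (asm) mult_le_cancel_left_pos) auto
qed

section \<open>Interval codes\<close>

text \<open>Shannon-Fano-Elias coding: the active request \<open>j\<close> of length \<open>l j\<close> occupies the interval of length
\<open>2\<^sup>-\<^sup>l\<^sup>j\<close> that starts where the previous active requests end, and its code word is an aligned dyadic
interval of half that length inside it.\<close>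

definition slot_start :: "(nat \<Rightarrow> bool) \<Rightarrow> (nat \<Rightarrow> nat) \<Rightarrow> nat \<Rightarrow> real" where
  "slot_start act l i = (\<Sum>j<i. of_bool (act j) * (1/2) ^ l j)"

definition covers :: "(nat \<Rightarrow> bool) \<Rightarrow> (nat \<Rightarrow> nat) \<Rightarrow> str \<Rightarrow> nat \<Rightarrow> bool" where
  "covers act l w i \<longleftrightarrow> act i \<and> length w = Suc (l i)
     \<and> slot_start act l i \<le> bval w / 2 ^ length w
     \<and> (bval w + 1) / 2 ^ length w \<le> slot_start act l (Suc i)"

lemma slot_start_mono: "i \<le> i' \<Longrightarrow> slot_start act l i \<le> slot_start act l i'"
  unfolding slot_start_def by (intro sum_mono2) auto

lemma slot_start_nonneg: "0 \<le> slot_start act l i"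
  unfolding slot_start_def by (intro sum_nonneg) auto

text \<open>The left end of the longer word's interval lies in the half-open intervals of both
  words, hence in both slots; distinct slots do not overlap, and all words of one slot have the same
  length. Unique decoding and prefix-freeness come at once.\<close>

lemma covers_unique:
  assumes "covers act l w i" "covers act l w' i'" "prefix w w'"
  shows "w = w' \<and> i = i'"
proof -
  obtain u where u: "w' = w @ u" using assms(3) by (auto simp: prefix_def)
  define pt where "pt = bval w' / (2::real) ^ length w'"
  have pt: "pt = (bval w + bval u / 2 ^ length u) / 2 ^ length w"
    by (simp add: pt_def u bval_append power_add add_divide_distrib)
  have "real (bval u) < real (2 ^ length u)"
    unfolding of_nat_less_iff by (rule bval_less)
  then have "bval u / (2::real) ^ length u < 1" by simp
  then have "bval w / 2 ^ length w \<le> pt" "pt < (bval w + 1) / 2 ^ length w"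
    unfolding pt by (auto intro!: divide_right_mono divide_strict_right_mono)
  then have i: "slot_start act l i \<le> pt" "pt < slot_start act l (Suc i)"
    using assms(1) by (auto simp: covers_def)
  have "pt < (bval w' + 1) / 2 ^ length w'" 
    unfolding pt_def by (intro divide_strict_right_mono) auto
  then have i': "slot_start act l i' \<le> pt" "pt < slot_start act l (Suc i')"
    using assms(2) by (auto simp: covers_def pt_def)
  have "\<not> i < i'" using slot_start_mono[of "Suc i" i' act l] i i' by force
  moreover have "\<not> i' < i" using slot_start_mono[of "Suc i'" i act l] i i' by force
  ultimately have "i = i'" by simp
  then have "length w = length w'" using assms(1,2) by (simp add: covers_def)
  then show ?thesis using \<open>i = i'\<close> u by simp
qed

text \<open>Round the left end of slot i up to the grid of width 2^-(l i + 1); the slot is two cells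
  wide, so a whole cell fits. A cell inside [0, 2^-k] has a word with k leading zeros, and q is the
  rest.\<close>

lemma covers_exists:
  assumes "act i" and le: "slot_start act l (Suc i) \<le> (1/2) ^ k"
  shows "\<exists>q. covers act l (replicate k False @ q) i \<and> length q + k = Suc (l i)"
proof -
  define n where "n = Suc (l i)"
  define a where "a = slot_start act l i"
  have a: "0 \<le> a" and Suc_a: "slot_start act l (Suc i) = a + 2 / 2 ^ n"
    using slot_start_nonneg assms(1) by (auto simp: a_def n_def slot_start_def power_divide)
  have "(1/2::real) ^ l i \<le> (1/2) ^ k"
    using Suc_a le a by (simp add: n_def power_divide)
  then have "k \<le> l i" using power_decreasing_iff[of "1/2::real" k "l i"] by simp
  define v where "v = nat \<lceil>a * 2 ^ n\<rceil>"
  have v_ge: "a * 2 ^ n \<le> v" and v_less: "v < a * 2 ^ n + 1"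
    using a unfolding v_def by (simp_all add: of_nat_nat) linarith+
  have v1: "(v + 1) / 2 ^ n \<le> slot_start act l (Suc i)"
  proof -
    have "a + 2 / 2 ^ n = (a * 2 ^ n + 2) / 2 ^ n" by (simp add: field_simps)
    then show ?thesis unfolding Suc_a
      by (simp only:) (intro divide_right_mono, use v_less in auto)
  qed
  then have "(v + 1) / 2 ^ n \<le> (1/2::real) ^ k" using le by linarith
  then have "real (v + 1) \<le> 2 ^ n * (1/2) ^ k"
    by (simp add: pos_divide_le_eq mult.commute)
  also have "2 ^ n * (1/2::real) ^ k = 2 ^ (n - k)"
    using power_diff[of "2::real" k n] \<open>k \<le> l i\<close> by (simp add: n_def power_divide)
  finally have "real (v + 1) \<le> real (2 ^ (n - k))" by simp
  then have "v < 2 ^ (n - k)" unfolding of_nat_le_iff by simp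
  then obtain q where q: "length q = n - k" "bval q = v" using ex_bval by blast
  then have "length (replicate k False @ q) = n" "bval (replicate k False @ q) = v"
    using \<open>k \<le> l i\<close> by (simp_all add: bval_append n_def)
  then have "covers act l (replicate k False @ q) i"
    using assms(1) v_ge v1 unfolding covers_def a_def n_def[symmetric]
    by (simp add: pos_le_divide_eq)
  then show ?thesis using q \<open>k \<le> l i\<close> by (auto simp: n_def)
qed

text \<open>The integer form of \<open>covers\<close>, with all lengths multiplied by \<open>2\<^sup>i\<close>; the truncated exponents
\<open>i - l j\<close> are the right ones only if \<open>l j \<le> j\<close>.\<close>

definition coversN :: "(nat \<Rightarrow> bool) \<Rightarrow> (nat \<Rightarrow> nat) \<Rightarrow> nat \<Rightarrow> nat \<Rightarrow> bool" where
  "coversN act l w i \<longleftrightarrow> act i \<and> len w = Suc (l i)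
     \<and> (\<Sum>j<i. of_bool (act j) * 2 ^ (i - l j)) * 2 ^ len w \<le> (Suc w - 2 ^ len w) * 2 ^ i
     \<and> (Suc w - 2 ^ len w + 1) * 2 ^ i \<le> (\<Sum>j<Suc i. of_bool (act j) * 2 ^ (i - l j)) * 2 ^ len w"

lemma coversN_iff:
  assumes "\<And>j. act j \<Longrightarrow> l j \<le> j"
  shows "coversN act l (enc w) i \<longleftrightarrow> covers act l w i"
proof -
  have sum: "real (\<Sum>j<m. of_bool (act j) * 2 ^ (i - l j)) = 2 ^ i * slot_start act l m" if "m \<le> Suc i" for m
  proof -
    have "real (of_bool (act j) * 2 ^ (i - l j)) = 2 ^ i * (of_bool (act j) * (1/2) ^ l j)" if "j < m" for j
      using that \<open>m \<le> Suc i\<close> assms[of j] power_diff[of "2::real" "l j" i]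
      by (cases "act j") (simp_all add: power_divide)
    then show ?thesis unfolding slot_start_def of_nat_sum sum_distrib_left by (intro sum.cong) auto
  qed
  have "(\<Sum>j<i. of_bool (act j) * 2 ^ (i - l j)) * 2 ^ length w \<le> bval w * 2 ^ i \<longleftrightarrow>
      real ((\<Sum>j<i. of_bool (act j) * 2 ^ (i - l j)) * 2 ^ length w) \<le> real (bval w * 2 ^ i)"
    by (simp only: of_nat_le_iff)
  also have "\<dots> \<longleftrightarrow> slot_start act l i \<le> bval w / 2 ^ length w"
    unfolding of_nat_mult using sum[of i] by (simp add: field_simps)
  finally have 1: "(\<Sum>j<i. of_bool (act j) * 2 ^ (i - l j)) * 2 ^ length w \<le> bval w * 2 ^ i \<longleftrightarrow>
      slot_start act l i \<le> bval w / 2 ^ length w" .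
  have "(bval w + 1) * 2 ^ i \<le> (\<Sum>j<Suc i. of_bool (act j) * 2 ^ (i - l j)) * 2 ^ length w \<longleftrightarrow>
      real ((bval w + 1) * 2 ^ i) \<le> real ((\<Sum>j<Suc i. of_bool (act j) * 2 ^ (i - l j)) * 2 ^ length w)"
    by (simp only: of_nat_le_iff)
  also have "\<dots> \<longleftrightarrow> real (bval w + 1) * 2 ^ i \<le> 2 ^ i * slot_start act l (Suc i) * 2 ^ length w"
    unfolding of_nat_mult sum[OF order.refl] by simp
  also have "\<dots> \<longleftrightarrow> 2 ^ i * real (bval w + 1) \<le> 2 ^ i * (slot_start act l (Suc i) * 2 ^ length w)"
    by (simp add: ac_simps)
  also have "\<dots> \<longleftrightarrow> (bval w + 1) / 2 ^ length w \<le> slot_start act l (Suc i)"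
    by (subst mult_le_cancel_left_pos) (simp_all add: pos_divide_le_eq)
  finally have 2: "(bval w + 1) * 2 ^ i \<le> (\<Sum>j<Suc i. of_bool (act j) * 2 ^ (i - l j)) * 2 ^ length w \<longleftrightarrow>
      (bval w + 1) / 2 ^ length w \<le> slot_start act l (Suc i)" .
  show ?thesis
    unfolding coversN_def covers_def len_enc bval_def[symmetric] 1 2 ..
qed

lemma decidable_coversN:
  assumes act: "decidable (\<lambda>A e. act A (e 0) (\<lambda>i. e (Suc i)))" and l: "computable (\<lambda>A e. l (e 0))"
    and "computable w" "computable i"
  shows "decidable (\<lambda>A e. coversN (\<lambda>j. act A j e) l (w A e) (i A e))"
proof -
  have "decidable (\<lambda>A e. coversN (\<lambda>j. act A j (\<lambda>k. e (Suc (Suc k)))) l (e 0) (e (Suc 0)))"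
    unfolding coversN_def
    by (intro computable_intros computable_len decidable_subst_Cons[OF act] computable_app1[OF l])
  from decidable_subst_Cons[of "\<lambda>A w e. coversN (\<lambda>j. act A j (\<lambda>k. e (Suc k))) l w (e 0)", OF this assms(3),
      of "\<lambda>A e. case_nat (i A e) e"]
  show ?thesis by (simp add: computable_env_Cons assms computable_var)
qed

section \<open>Universal prefix-free machines\<close>

lemma computable_app3:
  assumes "computable (\<lambda>A e. f (e 0) (e (Suc 0)) (e (Suc (Suc 0))))"
    and "computable a" and "computable b" and "computable c"
  shows "computable (\<lambda>A e. f (a A e) (b A e) (c A e))"
proof -
  have "computable (\<lambda>A e. case_nat (a A e) (case_nat (b A e) (\<lambda>_. c A e)) i)" for i
    by (intro computable_env_Cons assms)
  from computable_subst[OF assms(1),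
      of "\<lambda>i A e. case_nat (a A e) (case_nat (b A e) (\<lambda>_. c A e)) i", OF this]
  show ?thesis by simp
qed

lemma decidable_app3:
  assumes "decidable (\<lambda>A e. P (e 0) (e (Suc 0)) (e (Suc (Suc 0))))"
    and "computable a" and "computable b" and "computable c"
  shows "decidable (\<lambda>A e. P (a A e) (b A e) (c A e))"
  using computable_app3[of "\<lambda>x y z. of_bool (P x y z)"] assms unfolding decidable_def by blast

text \<open>Decoders are given as relations from here on. With w = w', \<open>unique\<close> makes
  \<open>W A\<close> a function; in general it makes the domain prefix-free. Both are required for
  every oracle, and in return one e serves all oracles.\<close>

lemma universal_pf_simulates:
  assumes U: "universal_pf U"
    and W: "semidecidable (\<lambda>A e. W A (e 0) (e (Suc 0)))"
    and unique: "\<And>A w w' v v'. W A (enc w) v \<Longrightarrow> W A (enc w') v' \<Longrightarrow> prefix w w' \<Longrightarrow> w = w' \<and> v = v'"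
  shows "\<exists>e. \<forall>A w v. U A (e @ w) = Some v \<longleftrightarrow> W A (enc w) (enc v)"
proof -
  have "\<exists>r. \<forall>A w v. eval A r [w] v \<longleftrightarrow> W A w v"
    using W
  proof (rule recf_of_semidecidable)
    fix A w v v' assume "W A w v" "W A w v'"
    then show "v = v'" using unique[of A "dec w" v "dec w" v'] by simp
  qed
  then obtain r where r: "\<And>A w v. eval A r [w] v \<longleftrightarrow> W A w v" by blast
  have phi: "phi A r w = Some v \<longleftrightarrow> W A (enc w) (enc v)" for A w v
    by (simp add: phi_eq_Some_iff r)
  have "prefix_free (dom (phi A r))" for A
    unfolding prefix_free_def using unique phi by blast
  then obtain e where "\<And>A p. U A (e @ p) = phi A r p"
    using U unfolding universal_pf_def by blast
  then have "\<forall>A w v. U A (e @ w) = Some v \<longleftrightarrow> W A (enc w) (enc v)" by (simp add: phi)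
  then show ?thesis ..
qed

lemma unary_prefix_unique:
  assumes "prefix (replicate m True @ [False]) (replicate n True @ [False])"
  shows "m = n"
proof -
  have tw: "takeWhile id (replicate k True @ False # xs) = replicate k True" for k xs
    by (induction k) simp_all
  obtain u where "replicate n True @ [False] = replicate m True @ False # u"
    using assms unfolding prefix_def by auto
  from arg_cong[OF this, of "takeWhile id"] have "replicate n True = replicate m True"
    unfolding tw .
  from arg_cong[OF this, of length] show ?thesis by simp
qed

lemma KA_le: "U A p = Some x \<Longrightarrow> KA U A x \<le> length p"
  unfolding KA_def by (intro Least_le) blast

text \<open>\<open>KA\<close> is a \<open>LEAST\<close>, which carries information only if some
  program outputs x; the unary words supply one for each x and each oracle.\<close>

lemma universal_pf_produces:
  assumes "universal_pf U"
  shows "\<exists>p. U A p = Some x"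
proof -
  have "\<exists>e. \<forall>A w v. U A (e @ w) = Some v \<longleftrightarrow> enc w = 2 ^ (enc v + 2) - 3"
  proof (rule universal_pf_simulates[OF assms])
    show "semidecidable (\<lambda>A e. e 0 = 2 ^ (e (Suc 0) + 2) - 3)"
      by (intro semidecidable_if_decidable computable_intros)
  next
    fix w w' v v'
    assume "enc w = 2 ^ (v + 2) - 3" "enc w' = 2 ^ (v' + 2) - 3" and pre: "prefix w w'"
    then have "w = replicate v True @ [False]" "w' = replicate v' True @ [False]"
      unfolding enc_unary[symmetric] inj_enc by blast+
    then show "w = w' \<and> v = v'" using pre unary_prefix_unique[of v v'] by simp
  qed
  then obtain e where "\<And>A w v. U A (e @ w) = Some v \<longleftrightarrow> enc w = 2 ^ (enc v + 2) - 3" by blast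
  then have "U A (e @ replicate (enc x) True @ [False]) = Some x"
    by (simp only: enc_unary)
  then show ?thesis by blast
qed

lemma KA_attained:
  assumes "universal_pf U"
  shows "\<exists>p. length p = KA U A x \<and> U A p = Some x"
  unfolding KA_def by (rule LeastI_ex) (use universal_pf_produces[OF assms] in blast)

text \<open>On input 1^n 0, with n the code of (a, b), a machine searches for t and then outputs the
  empty string; \<open>d\<close> computes the number of the corresponding program of U.\<close>

lemma halting_decides:
  assumes U: "universal_pf U"
    and R: "decidable (\<lambda>A e. R (e 0) (e (Suc 0)) (e (Suc (Suc 0))))"
  shows "\<exists>d. computable (\<lambda>A e. d (e 0) (e (Suc 0))) \<and> (\<forall>a b. halting U (d a b) \<longleftrightarrow> (\<exists>t. R t a b))"
proof -
  define W where "W w v \<longleftrightarrow> (\<exists>a b t. v = 0 \<and> w = 2 ^ (prod_encode (a, b) + 2) - 3 \<and> R t a b)"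
    for w v :: nat
  have "\<exists>e. \<forall>A w v. U A (e @ w) = Some v \<longleftrightarrow> W (enc w) (enc v)"
  proof (rule universal_pf_simulates[OF U])
    show "semidecidable (\<lambda>A e. W (e 0) (e (Suc 0)))"
      unfolding W_def
      by (intro semidecidable_ex, rule semidecidable_if_decidable,
          intro computable_intros computable_prod_encode decidable_app3[OF R])
  next
    fix w w' v v'
    assume "W (enc w) v" "W (enc w') v'" and pre: "prefix w w'"
    then obtain n n' where "v = 0" "v' = 0" and w: "w = replicate n True @ [False]" "w' = replicate n' True @ [False]"
      unfolding W_def enc_unary[symmetric] inj_enc by blast
    then show "w = w' \<and> v = v'" using pre unary_prefix_unique[of n n'] by simp
  qed
  then obtain e where e: "\<And>A w v. U A (e @ w) = Some v \<longleftrightarrow> W (enc w) (enc v)" by blast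
  define d where "d a b = enc (e @ replicate (prod_encode (a, b)) True @ [False])" for a b
  have "d a b = enc e * 2 ^ Suc (prod_encode (a, b)) + (2 ^ (prod_encode (a, b) + 2) - 3)" for a b
    unfolding d_def enc_append[of e] enc_unary by simp
  moreover have "computable (\<lambda>A k. enc e * 2 ^ Suc (prod_encode (k 0, k (Suc 0))) +
      (2 ^ (prod_encode (k 0, k (Suc 0)) + 2) - 3))"
    by (intro computable_add computable_mult computable_power computable_diff computable_Suc
        computable_prod_encode computable_const computable_var)
  ultimately have "computable (\<lambda>A e. d (e 0) (e (Suc 0)))" by simp
  moreover have "halting U (d a b) \<longleftrightarrow> (\<exists>t. R t a b)" for a b
  proof -
    have "halting U (d a b) \<longleftrightarrow> (\<exists>v. U no_oracle (e @ replicate (prod_encode (a, b)) True @ [False]) = Some v)"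
      unfolding halting_def d_def inj_enc by simp
    also have "\<dots> \<longleftrightarrow> (\<exists>v a' b' t. enc v = 0 \<and> prod_encode (a, b) = prod_encode (a', b') \<and> R t a' b')"
      unfolding e W_def enc_unary[symmetric] inj_enc by simp
    also have "\<dots> \<longleftrightarrow> (\<exists>t. R t a b)"
      using inj_enc[of _ "[]"] by (auto simp: prod_encode_eq)
    finally show ?thesis .
  qed
  ultimately show ?thesis by blast
qed

section \<open>Stagewise approximation of U without oracle\<close>

locale staged_universal =
  fixes U :: "(nat \<Rightarrow> bool) \<Rightarrow> str \<Rightarrow> str option" and stage :: "nat \<Rightarrow> nat \<Rightarrow> nat"
  assumes universal: "universal_pf U"
    and computable_stage0: "computable (\<lambda>A e. stage (e 0) (e (Suc 0)))"
    and stage_mono: "t \<le> t' \<Longrightarrow> stage t p = Suc x \<Longrightarrow> stage t' p = Suc x"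
    and U_iff_stage: "U no_oracle (dec p) = Some (dec x) \<longleftrightarrow> (\<exists>t. stage t p = Suc x)"
begin

lemmas computable_stage = computable_app2[OF computable_stage0]

lemma U_if_stage: "stage t p = Suc x \<Longrightarrow> U no_oracle (dec p) = Some (dec x)"
  using U_iff_stage by blast

lemma stage_unique: "stage t p = Suc x \<Longrightarrow> stage t' p = Suc x' \<Longrightarrow> x = x'"
  using stage_mono[of t "max t t'" p x] stage_mono[of t' "max t t'" p x'] by simp

lemma stage_prefix_free:
  assumes "stage t p = Suc x" "stage t' p' = Suc x'" "prefix (dec p) (dec p')"
  shows "p = p'"
proof -
  have "prefix_free (dom (U no_oracle))"
    using universal unfolding universal_pf_def by blast
  then have "dec p = dec p'"
    unfolding prefix_free_def using U_if_stage[OF assms(1)] U_if_stage[OF assms(2)] assms(3) by blast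
  then show ?thesis by (metis enc_dec)
qed

definition hit :: "nat \<Rightarrow> nat \<Rightarrow> nat \<Rightarrow> bool" where
  "hit z t p \<longleftrightarrow> (\<exists>y<stage t p. stage t p = Suc (npair z y))"

text \<open>The bound on y in \<open>hit\<close> makes it decidable and costs nothing, because y is
  smaller than \<open>npair z y\<close>.\<close>

lemma hit_iff: "hit z t p \<longleftrightarrow> (\<exists>y. stage t p = Suc (npair z y))"
  unfolding hit_def using less_npair by (metis less_SucI)

lemma hit_mono: "t \<le> t' \<Longrightarrow> hit z t p \<Longrightarrow> hit z t' p"
  unfolding hit_iff using stage_mono by blast

lemma hit_unique: "hit z t p \<Longrightarrow> hit z' t p \<Longrightarrow> z = z'"
  unfolding hit_iff by (auto simp: npair_inject)

lemma decidable_hit: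
  assumes "computable z" "computable t" "computable p"
  shows "decidable (\<lambda>A e. hit (z A e) (t A e) (p A e))"
proof -
  have "decidable (\<lambda>A e. hit (e 0) (e (Suc 0)) (e (Suc (Suc 0))))"
    unfolding hit_def by (intro computable_intros computable_stage computable_npair)
  from decidable_app3[OF this assms] show ?thesis .
qed

text \<open>A lower approximation of m(z): only programs numbered below t that have halted by stage
  t count, so the sum is finite and grows with t.\<close>

definition weight :: "nat \<Rightarrow> nat \<Rightarrow> real" where
  "weight t z = (\<Sum>p<t. of_bool (hit z t p) * (1/2) ^ len p)"

lemma weight_mono:
  assumes "t \<le> t'"
  shows "weight t z \<le> weight t' z"
proof -
  have "weight t z \<le> (\<Sum>p<t. of_bool (hit z t' p) * (1/2) ^ len p)"
    unfolding weight_def using hit_mono[OF assms] by (intro sum_mono) auto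
  also have "\<dots> \<le> weight t' z"
    unfolding weight_def using assms by (intro sum_mono2) auto
  finally show ?thesis .
qed

lemma sum_stage_le: "(\<Sum>p | p < m \<and> stage m p \<noteq> 0. (1/2) ^ len p) \<le> (1::real)"
proof -
  define S where "S = {p. p < m \<and> stage m p \<noteq> 0}"
  have "p = p'" if *: "p \<in> S" "p' \<in> S" "prefix (dec p) (dec p')" for p p'
  proof -
    obtain x x' where "stage m p = Suc x" "stage m p' = Suc x'"
      using *(1,2) unfolding S_def by (cases "stage m p"; cases "stage m p'") auto
    then show ?thesis using stage_prefix_free *(3) by blast
  qed
  then have "prefix_free (dec ` S)" unfolding prefix_free_def by blast
  then have "(\<Sum>w\<in>dec ` S. (1/2) ^ length w) \<le> (1::real)"
    by (intro kraft_inequality) (simp_all add: S_def)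
  also have "(\<Sum>w\<in>dec ` S. (1/2::real) ^ length w) = (\<Sum>p\<in>S. (1/2) ^ len p)"
  proof (subst sum.reindex)
    show "inj_on dec S" by (rule inj_on_inverseI[of _ enc]) simp
    show "sum ((\<lambda>w. (1/2::real) ^ length w) \<circ> dec) S = (\<Sum>p\<in>S. (1/2) ^ len p)"
      by (intro sum.cong) (auto simp flip: len_enc)
  qed
  finally show ?thesis unfolding S_def .
qed

text \<open>A halted program outputs at most one pair and so counts for at most one z; Kraft's
  inequality bounds the total.\<close>

lemma sum_weight_le: "(\<Sum>z<k. weight m z) \<le> 1"
proof -
  have "(\<Sum>z<k. weight m z) = (\<Sum>p<m. \<Sum>z<k. of_bool (hit z m p) * (1/2) ^ len p)"
    unfolding weight_def by (rule sum.swap)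
  also have "\<dots> \<le> (\<Sum>p<m. of_bool (stage m p \<noteq> 0) * (1/2) ^ len p)"
  proof (rule sum_mono)
    fix p
    show "(\<Sum>z<k. of_bool (hit z m p) * (1/2::real) ^ len p) \<le> of_bool (stage m p \<noteq> 0) * (1/2) ^ len p"
    proof (cases "\<exists>z. hit z m p")
      case True
      then obtain z where z: "hit z m p" by blast
      then have "hit z' m p \<longleftrightarrow> z' = z" for z' using hit_unique by blast
      then have eq: "(\<Sum>z<k. of_bool (hit z m p) * (1/2::real) ^ len p) =
          (\<Sum>z'<k. if z' = z then (1/2) ^ len p else 0)"
        by (intro sum.cong) auto
      have "stage m p \<noteq> 0" using z by (auto simp: hit_iff)
      then show ?thesis unfolding eq by simp
    qed simp
  qed
  also have "\<dots> = (\<Sum>p | p < m \<and> stage m p \<noteq> 0. (1/2) ^ len p)"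
    by (simp add: of_bool_def if_distrib[of "\<lambda>x. x * _"] sum.If_cases lessThan_def Int_def Collect_conj_eq[symmetric] cong: if_cong)
  also have "\<dots> \<le> 1" by (rule sum_stage_le)
  finally show ?thesis .
qed

lemma weight_le_1: "weight m z \<le> 1"
proof -
  have "weight m z \<le> (\<Sum>z<Suc z. weight m z)"
    by (rule member_le_sum) (auto simp: weight_def intro!: sum_nonneg)
  then show ?thesis using sum_weight_le[of m "Suc z"] by linarith
qed

text \<open>The test weight > 2^(1-n), cleared of denominators by the factor 2^(n+t). The exponent
  \<open>t - len p\<close> is exact because \<open>len p \<le> p\<close> and p < t.\<close>

definition heavy :: "nat \<Rightarrow> nat \<Rightarrow> nat \<Rightarrow> bool" where
  "heavy t z n \<longleftrightarrow> (2::nat) * 2 ^ t < 2 ^ n * (\<Sum>p<t. of_bool (hit z t p) * 2 ^ (t - len p))"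

lemma heavy_iff: "heavy t z n \<longleftrightarrow> 2 * (1/2) ^ n < weight t z"
proof -
  have "real (of_bool (hit z t p) * 2 ^ (t - len p)) = 2 ^ t * (of_bool (hit z t p) * (1/2) ^ len p)"
    if "p < t" for p
    using that len_le[of p] power_diff[of "2::real" "len p" t] by (simp add: power_divide)
  then have sum: "real (\<Sum>p<t. of_bool (hit z t p) * 2 ^ (t - len p)) = 2 ^ t * weight t z"
    unfolding weight_def of_nat_sum sum_distrib_left by (intro sum.cong) auto
  have "heavy t z n \<longleftrightarrow> real (2 * 2 ^ t) < real (2 ^ n * (\<Sum>p<t. of_bool (hit z t p) * 2 ^ (t - len p)))"
    unfolding heavy_def of_nat_less_iff ..
  also have "\<dots> \<longleftrightarrow> 2 ^ t * 2 < 2 ^ t * (2 ^ n * weight t z)"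
    unfolding of_nat_mult sum by (simp add: ac_simps)
  also have "\<dots> \<longleftrightarrow> 2 < 2 ^ n * weight t z" by (subst mult_less_cancel_left_pos) auto
  also have "\<dots> \<longleftrightarrow> 2 / 2 ^ n < weight t z" by (simp add: pos_divide_less_eq mult.commute)
  finally show ?thesis by (simp add: power_divide)
qed

lemma decidable_heavy0: "decidable (\<lambda>A e. heavy (e 0) (e (Suc 0)) (e (Suc (Suc 0))))"
  unfolding heavy_def by (intro computable_intros decidable_hit computable_len)

lemmas decidable_heavy = decidable_app3[OF decidable_heavy0]

text \<open>The request \<open>\<langle>z, \<langle>n, t\<rangle>\<rangle>\<close> is active if \<open>t\<close> is the first stage at which the weight of \<open>z\<close> exceeds
\<open>2\<^sup>1\<^sup>-\<^sup>n\<close>. So each \<open>n\<close> counts once, and the active lengths for \<open>z\<close> form a geometric series below its weight.\<close>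

definition weight_request :: "nat \<Rightarrow> bool" where
  "weight_request i \<longleftrightarrow> heavy (psnd (psnd i)) (pfst i) (pfst (psnd i))
     \<and> (\<forall>t<psnd (psnd i). \<not> heavy t (pfst i) (pfst (psnd i)))"

definition weight_length :: "nat \<Rightarrow> nat" where
  "weight_length i = pfst (psnd i)"

lemma weight_length_le: "weight_length i \<le> i"
  unfolding weight_length_def using pfst_le psnd_le order.trans by blast

lemma decidable_weight_request: "decidable (\<lambda>A e. weight_request (e 0))"
  unfolding weight_request_def
  by (intro computable_intros decidable_heavy computable_pfst computable_psnd)

lemma computable_weight_length: "computable (\<lambda>A e. weight_length (e 0))"
  unfolding weight_length_def by (intro computable_pfst computable_psnd computable_var)

text \<open>The sum is at most twice its largest term, and the hypothesis has that factor 2 built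
  in; this is the reason for the factor 2 in \<open>heavy\<close>.\<close>

lemma sum_half_powers_le:
  assumes "finite N" "\<And>n. n \<in> N \<Longrightarrow> 2 * (1/2) ^ n < c" "0 \<le> c"
  shows "(\<Sum>n\<in>N. (1/2) ^ n) \<le> (c::real)"
proof (cases "N = {}")
  case False
  define a where "a = Min N"
  have a: "a \<in> N" "\<And>n. n \<in> N \<Longrightarrow> a \<le> n" using False assms(1) by (auto simp: a_def)
  have "(\<Sum>n\<in>N. (1/2) ^ n) \<le> (\<Sum>n=a..<Suc (Max N). (1/2::real) ^ n)"
    using a(2) assms(1) by (intro sum_mono2) (auto simp: less_Suc_eq_le)
  also have "\<dots> \<le> 2 * (1/2) ^ a"
  proof -
    have "(\<Sum>n=a..<b. (1/2::real) ^ n) = 2 * (1/2) ^ a - 2 * (1/2) ^ b" if "a \<le> b" for b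
      using that by (induction b rule: dec_induct) simp_all
    moreover have "a \<le> Suc (Max N)" using a(1) assms(1) by (simp add: le_SucI)
    ultimately show ?thesis by simp
  qed
  also have "\<dots> \<le> c" using assms(2)[OF a(1)] by simp
  finally show ?thesis .
qed (simp add: assms)

text \<open>An active request is determined by z and n, so the sum may run over pairs (z, n). An
  index below m bounds the stage by m, so the weight at stage m dominates.\<close>

lemma slot_start_weight_request_le: "slot_start weight_request weight_length m \<le> 1"
proof -
  define Z where "Z = (\<lambda>i. (pfst i, weight_length i)) ` {i. i < m \<and> weight_request i}"
  have "i = i'" if "weight_request i" "weight_request i'" "pfst i = pfst i'" "weight_length i = weight_length i'" for i i'
  proof -
    have "psnd (psnd i) = psnd (psnd i')"
      using that unfolding weight_request_def weight_length_def by (metis linorder_neqE_nat)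
    then show ?thesis using that(3,4) unfolding weight_length_def by (metis prod_encode_pfst_psnd)
  qed
  then have inj: "inj_on (\<lambda>i. (pfst i, weight_length i)) {i. i < m \<and> weight_request i}" by (auto intro!: inj_onI)
  have Z_sub: "Z \<subseteq> (SIGMA z:{..<m}. {n. n < m \<and> 2 * (1/2) ^ n < weight m z})"
  proof -
    have "pfst i < m \<and> weight_length i < m \<and> 2 * (1/2) ^ weight_length i < weight m (pfst i)" if "i < m" "weight_request i" for i
    proof -
      have "psnd (psnd i) \<le> m" using psnd_le[of i] psnd_le[of "psnd i"] that(1) by linarith
      moreover have "2 * (1/2) ^ weight_length i < weight (psnd (psnd i)) (pfst i)"
        using that(2) unfolding weight_request_def weight_length_def heavy_iff by blast
      ultimately have "2 * (1/2) ^ weight_length i < weight m (pfst i)" using weight_mono by (meson less_le_trans)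
      then show ?thesis using that(1) pfst_le[of i] weight_length_le[of i] by linarith
    qed
    then show ?thesis by (auto simp: Z_def)
  qed
  have "slot_start weight_request weight_length m = (\<Sum>i | i < m \<and> weight_request i. (1/2) ^ weight_length i)"
    unfolding slot_start_def
    by (simp add: of_bool_def if_distrib[of "\<lambda>x. x * _"] sum.If_cases lessThan_def Int_def cong: if_cong)
  also have "\<dots> = (\<Sum>(z, n)\<in>Z. (1/2) ^ n)"
    unfolding Z_def by (subst sum.reindex[OF inj]) simp
  also have "\<dots> \<le> (\<Sum>(z, n)\<in>(SIGMA z:{..<m}. {n. n < m \<and> 2 * (1/2) ^ n < weight m z}). (1/2) ^ n)"
    using Z_sub by (intro sum_mono2) auto
  also have "\<dots> = (\<Sum>z<m. \<Sum>n | n < m \<and> 2 * (1/2) ^ n < weight m z. (1/2) ^ n)"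
    by (subst sum.Sigma) auto
  also have "\<dots> \<le> (\<Sum>z<m. weight m z)"
    by (intro sum_mono sum_half_powers_le) (auto simp: weight_def intro!: sum_nonneg)
  also have "\<dots> \<le> 1" by (rule sum_weight_le)
  finally show ?thesis .
qed

text \<open>This is K(z) <= -log m(z) + O(1). Activity is decidable, so a decoder can compute the
  earlier slots and search for the request whose slot contains the interval of its input.\<close>

lemma coding_theorem: "\<exists>c. \<forall>t z n. heavy t (enc z) n \<longrightarrow> Kc U z \<le> n + c"
proof -
  define W where "W w z \<longleftrightarrow> (\<exists>n t. coversN weight_request weight_length w (prod_encode (z, prod_encode (n, t))))" for w z
  have cov: "coversN weight_request weight_length (enc w) i \<longleftrightarrow> covers weight_request weight_length w i" for w i
    by (rule coversN_iff) (rule weight_length_le)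
  have "\<exists>e. \<forall>A w v. U A (e @ w) = Some v \<longleftrightarrow> W (enc w) (enc v)"
  proof (rule universal_pf_simulates[OF universal])
    show "semidecidable (\<lambda>A e. W (e 0) (e (Suc 0)))"
      unfolding W_def
      by (intro semidecidable_ex, rule semidecidable_if_decidable, rule decidable_coversN)
        (intro decidable_weight_request computable_weight_length computable_prod_encode computable_var)+
  next
    fix w w' v v'
    assume "W (enc w) v" "W (enc w') v'" and pre: "prefix w w'"
    then obtain n t n' t' where "covers weight_request weight_length w (prod_encode (v, prod_encode (n, t)))"
      "covers weight_request weight_length w' (prod_encode (v', prod_encode (n', t')))"
      unfolding W_def cov by blast
    from covers_unique[OF this pre] show "w = w' \<and> v = v'" by (simp add: prod_encode_eq)
  qed
  then obtain e where e: "\<And>A w v. U A (e @ w) = Some v \<longleftrightarrow> W (enc w) (enc v)" by blast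
  have "Kc U z \<le> n + (1 + length e)" if "heavy t (enc z) n" for t z n
  proof -
    obtain s where s: "heavy s (enc z) n" "\<forall>s'<s. \<not> heavy s' (enc z) n"
      using \<open>heavy t (enc z) n\<close> exists_least_iff[of "\<lambda>t. heavy t (enc z) n"] by blast
    define i where "i = prod_encode (enc z, prod_encode (n, s))"
    have "weight_request i" using s by (simp add: weight_request_def i_def)
    \<comment> \<open>At k = 0, \<open>covers_exists\<close> asks only that the slots fit into
      [0, 1].\<close>
    then obtain q where q: "covers weight_request weight_length q i" "length q = Suc n"
      using covers_exists[of weight_request i weight_length 0] slot_start_weight_request_le by (auto simp: weight_length_def i_def)
    then have "U no_oracle (e @ q) = Some z" unfolding e W_def cov i_def by blast
    from KA_le[of U, OF this] show ?thesis using q(2) by (simp add: Kc_def)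
  qed
  then show ?thesis by blast
qed

text \<open>The request \<open>\<langle>p, t\<rangle>\<close> is active if \<open>t\<close> is the first stage at which \<open>p\<close> halts, with output \<open>\<langle>z, y\<rangle>\<close>.\<close>

definition program_request :: "nat \<Rightarrow> nat \<Rightarrow> bool" where
  "program_request z i \<longleftrightarrow> hit z (psnd i) (pfst i) \<and> (\<forall>t<psnd i. stage t (pfst i) = 0)"

definition program_length :: "nat \<Rightarrow> nat" where
  "program_length i = len (pfst i)"

lemma program_length_le: "program_length i \<le> i"
  unfolding program_length_def using len_le pfst_le order.trans by blast

lemma computable_program_length: "computable (\<lambda>A e. program_length (e 0))"
  unfolding program_length_def by (intro computable_len computable_pfst computable_var)

lemma decidable_program_request:
  assumes "computable z" "computable i"
  shows "decidable (\<lambda>A e. program_request (z A e) (i A e))"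
proof -
  have "decidable (\<lambda>A e. program_request (e 0) (e (Suc 0)))"
    unfolding program_request_def
    by (intro computable_intros decidable_hit computable_pfst computable_psnd computable_stage)
  then show ?thesis
    using computable_app2[of "\<lambda>z i. of_bool (program_request z i)"] assms unfolding decidable_def by blast
qed

text \<open>Each program makes one request, and an index below m bounds its number and its halting
  stage, so every active request is a program counted in \<open>weight m z\<close>. This is what
  forces leading zeros on the code words for a fixed z.\<close>

lemma slot_start_program_request_le: "slot_start (program_request z) program_length m \<le> weight m z"
proof -
  have "i = i'" if "program_request z i" "program_request z i'" "pfst i = pfst i'" for i i'
  proof -
    have "psnd i = psnd i'"
      using that unfolding program_request_def hit_iff by (metis linorder_neqE_nat nat.distinct(1))
    then show ?thesis using that(3) by (metis prod_encode_pfst_psnd)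
  qed
  then have inj: "inj_on pfst {i. i < m \<and> program_request z i}" by (auto intro!: inj_onI)
  have sub: "pfst ` {i. i < m \<and> program_request z i} \<subseteq> {p. p < m \<and> hit z m p}"
  proof -
    have "pfst i < m \<and> hit z m (pfst i)" if "i < m" "program_request z i" for i
      using that pfst_le[of i] psnd_le[of i] hit_mono[of "psnd i" m z "pfst i"] by (auto simp: program_request_def)
    then show ?thesis by auto
  qed
  have "slot_start (program_request z) program_length m = (\<Sum>i | i < m \<and> program_request z i. (1/2) ^ len (pfst i))"
    unfolding slot_start_def program_length_def
    by (simp add: of_bool_def if_distrib[of "\<lambda>x. x * _"] sum.If_cases lessThan_def Int_def cong: if_cong)
  also have "\<dots> = (\<Sum>p\<in>pfst ` {i. i < m \<and> program_request z i}. (1/2) ^ len p)"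
    by (subst sum.reindex[OF inj]) simp
  also have "\<dots> \<le> (\<Sum>p | p < m \<and> hit z m p. (1/2) ^ len p)"
    using sub by (intro sum_mono2) auto
  also have "\<dots> = weight m z"
    unfolding weight_def
    by (simp add: of_bool_def if_distrib[of "\<lambda>x. x * _"] sum.If_cases lessThan_def Int_def cong: if_cong)
  finally show ?thesis .
qed

end

lemma ex_staged_universal:
  assumes U: "universal_pf U"
  shows "\<exists>stage. staged_universal U stage"
proof -
  obtain r where r: "\<And>A. U A = phi A r"
    using U unfolding universal_pf_def by blast
  obtain F where F: "computable (\<lambda>A e. F A (e 0) (\<lambda>i. e (Suc i)))"
    and F_mono: "\<And>A t t' e v. t \<le> t' \<Longrightarrow> F A t e = Suc v \<Longrightarrow> F A t' e = Suc v"
    and F_iff: "\<And>A e v. eval A r (map e [0..<1]) v \<longleftrightarrow> (\<exists>t. F A t e = Suc v)"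
    using stage_function_exists[of r 1] by blast
  \<comment> \<open>The empty oracle is fixed inside \<open>stage\<close>, so a machine with any
    oracle can approximate U without oracle.\<close>
  define stage where "stage t p = F no_oracle t (\<lambda>_. p)" for t p
  have "staged_universal U stage"
  proof
    show "universal_pf U" by (rule U)
    have "computable (\<lambda>A e. F no_oracle (e 0) (\<lambda>i. e (Suc i)))"
      using computable_no_oracle[OF F] .
    from computable_subst_Cons[of "\<lambda>_. F no_oracle", OF this computable_var, of "\<lambda>_ e _. e (Suc 0)"]
    show "computable (\<lambda>A e. stage (e 0) (e (Suc 0)))"
      unfolding stage_def by (simp add: computable_var)
    show "stage t p = Suc x \<Longrightarrow> t \<le> t' \<Longrightarrow> stage t' p = Suc x" for t t' p x
      unfolding stage_def using F_mono by blast
    show "U no_oracle (dec p) = Some (dec x) \<longleftrightarrow> (\<exists>t. stage t p = Suc x)" for p x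
      using F_iff[of no_oracle "\<lambda>_. p" x] by (simp add: r phi_eq_Some_iff stage_def)
  qed
  then show ?thesis by blast
qed

section \<open>Codes of the pair x, y\<close>

context staged_universal
begin

lemma ex_stage:
  assumes "U no_oracle p = Some x"
  shows "\<exists>t. stage t (enc p) = Suc (enc x)"
  using U_iff_stage[of "enc p" "enc x"] assms by simp

text \<open>Programs of U are self-delimiting: the halting program at the start of an input is
  unique and fixes where the remainder begins.\<close>

lemma concat_stage_unique:
  assumes "stage s p = Suc x" "stage s' p' = Suc x'" "prefix (dec p @ q) (dec p' @ q')"
  shows "p = p' \<and> x = x' \<and> prefix q q'"
proof -
  have "prefix (dec p) (dec p' @ q')" "prefix (dec p') (dec p' @ q')"
    using assms(3) by (auto intro: append_prefixD)
  then have "prefix (dec p) (dec p') \<or> prefix (dec p') (dec p)" by (rule prefix_same_cases)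
  then have p: "p = p'"
    using stage_prefix_free[OF assms(1,2)] stage_prefix_free[OF assms(2,1)] by blast
  then show ?thesis using assms stage_unique by auto
qed

text \<open>The decoder works on p @ q: p yields x, the oracle yields the limit z and the threshold
  n, and q preceded by n - 2 zeros picks the slot of a program of some \<open>pair_str z y\<close>.
  The threshold enters K(z) and the length of q with opposite signs, hence the sum on the
  left.\<close>

lemma conditional_coding:
  assumes g: "computable (\<lambda>A e. g (e 0) (e (Suc 0)))"
  shows "\<exists>c. \<forall>x y z. (\<exists>t0. \<forall>t\<ge>t0. g (enc x) t = enc z) \<longrightarrow>
    Kc U z + KA U (halting U) (pair_str x y) \<le> Kc U x + Kc U (pair_str z y) + c"
proof -
  obtain c where c: "\<And>t z n. heavy t (enc z) n \<Longrightarrow> Kc U z \<le> n + c"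
    using coding_theorem by blast
  have "decidable (\<lambda>A e. e (Suc (Suc 0)) \<le> e 0 \<and> \<not> g (e (Suc 0)) (e 0) = g (e (Suc 0)) (e (Suc (Suc 0))))"
    by (intro computable_intros computable_app2[OF g])
  from halting_decides[OF universal, of "\<lambda>t x t0. t0 \<le> t \<and> \<not> g x t = g x t0", OF this]
  obtain d1 where d1: "computable (\<lambda>A e. d1 (e 0) (e (Suc 0)))"
    and d1_iff: "\<And>x t0. halting U (d1 x t0) \<longleftrightarrow> (\<exists>t. t0 \<le> t \<and> g x t \<noteq> g x t0)"
    by blast
  from halting_decides[OF universal, OF decidable_heavy0]
  obtain d2 where d2: "computable (\<lambda>A e. d2 (e 0) (e (Suc 0)))"
    and d2_iff: "\<And>z n. halting U (d2 z n) \<longleftrightarrow> (\<exists>t. heavy t z n)"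
    by blast
  \<comment> \<open>For A = \<open>halting U\<close>, \<open>d1\<close> tells whether the output
    ever differs again from that at t0, so the least t0 with answer no gives the limit. Leastness
    makes t0 here, and n in \<open>thr\<close>, unique under every oracle.\<close>
  define lim where "lim A x z t0 \<longleftrightarrow> z = g x t0 \<and> \<not> A (d1 x t0) \<and> (\<forall>t<t0. A (d1 x t))"
    for A :: "nat \<Rightarrow> bool" and x z t0
  define thr where "thr A z n \<longleftrightarrow> A (d2 z n) \<and> (\<forall>m<n. \<not> A (d2 z m))"
    for A :: "nat \<Rightarrow> bool" and z n
  \<comment> \<open>This is the number of 0^(n-2) q, as 0^k has number \<open>2 ^ k - 1\<close>. For
    \<open>halting U\<close> the threshold is at least 2; for other oracles only unique decoding
    matters.\<close>
  define code where "code v x z y n q i \<longleftrightarrow>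
      coversN (program_request z) program_length ((2 ^ (n - 2) - 1) * 2 ^ len q + q) i
      \<and> stage (psnd i) (pfst i) = Suc (npair z y) \<and> v = npair x y" for v x z y n q i
  define W where "W A w v \<longleftrightarrow> (\<exists>p q s x t0 z n i y. w = p * 2 ^ len q + q \<and> stage s p = Suc x
      \<and> lim A x z t0 \<and> thr A z n \<and> code v x z y n q i)" for A w v
  have zeros: "(2 ^ k - 1) * 2 ^ len (enc q) + enc q = enc (replicate k False @ q)" for k q
  proof -
    have "enc (replicate k False) = 2 ^ k - 1"
      using Suc_enc_eq[of "replicate k False"] by simp
    then show ?thesis by (simp add: enc_append)
  qed
  have cov: "coversN (program_request z) program_length (enc w) i \<longleftrightarrow> covers (program_request z) program_length w i" for z w i
    by (rule coversN_iff) (rule program_length_le)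
  have W_str: "W A (enc w) v \<longleftrightarrow> (\<exists>p q s x t0 z n i y. w = dec p @ q \<and> stage s p = Suc x
      \<and> lim A x z t0 \<and> thr A z n \<and> covers (program_request z) program_length (replicate (n - 2) False @ q) i
      \<and> stage (psnd i) (pfst i) = Suc (npair z y) \<and> v = npair x y)" for A w v
  proof -
    have split: "enc w = p * 2 ^ len q + q \<longleftrightarrow> w = dec p @ dec q" for p q
      using enc_append[of "dec p" "dec q"] inj_enc[of w "dec p @ dec q"] len_enc[of "dec q"] by simp
    have "W A (enc w) v \<longleftrightarrow> (\<exists>p q s x t0 z n i y. w = dec p @ dec q \<and> stage s p = Suc x
      \<and> lim A x z t0 \<and> thr A z n \<and> covers (program_request z) program_length (replicate (n - 2) False @ dec q) i
      \<and> stage (psnd i) (pfst i) = Suc (npair z y) \<and> v = npair x y)"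
      unfolding W_def code_def split using zeros[of _ "dec _"] cov by simp
    then show ?thesis by (metis dec_enc)
  qed
  have "\<exists>e. \<forall>A w v. U A (e @ w) = Some v \<longleftrightarrow> W A (enc w) (enc v)"
  proof (rule universal_pf_simulates[OF universal])
    show "semidecidable (\<lambda>A e. W A (e 0) (e (Suc 0)))"
      unfolding W_def lim_def thr_def code_def
      by (intro semidecidable_ex, rule semidecidable_if_decidable,
          intro computable_intros decidable_coversN decidable_program_request computable_program_length computable_len
            computable_stage computable_npair computable_pfst computable_psnd
            computable_app2[OF g] computable_app2[OF d1] computable_app2[OF d2])
  next
    fix A w w' v v'
    assume "W A (enc w) v" and "W A (enc w') v'" and pre: "prefix w w'"
    from \<open>W A (enc w) v\<close> obtain p q s x t0 z n i y where w: "w = dec p @ q" "stage s p = Suc x"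
      "lim A x z t0" "thr A z n" "covers (program_request z) program_length (replicate (n - 2) False @ q) i"
      "stage (psnd i) (pfst i) = Suc (npair z y)" "v = npair x y"
      unfolding W_str by blast
    from \<open>W A (enc w') v'\<close> obtain p' q' s' x' t0' z' n' i' y' where w': "w' = dec p' @ q'" "stage s' p' = Suc x'"
      "lim A x' z' t0'" "thr A z' n'" "covers (program_request z') program_length (replicate (n' - 2) False @ q') i'"
      "stage (psnd i') (pfst i') = Suc (npair z' y')" "v' = npair x' y'"
      unfolding W_str by blast
    \<comment> \<open>Each value is fixed by those before it: p and x, then t0 and z, then n, then q
      and i, and finally y.\<close>
    have px: "p = p'" "x = x'" and q: "prefix q q'"
      using concat_stage_unique[OF w(2) w'(2)] pre unfolding w(1) w'(1) by blast+
    have "t0 = t0'"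
      using w(3) w'(3) unfolding px lim_def by (metis linorder_neqE_nat)
    then have z: "z = z'" using w(3) w'(3) unfolding px lim_def by simp
    have n: "n = n'"
      using w(4) w'(4) unfolding z thr_def by (metis linorder_neqE_nat)
    have "replicate (n - 2) False @ q = replicate (n - 2) False @ q' \<and> i = i'"
      using covers_unique[OF w(5), of "replicate (n' - 2) False @ q'" i'] w'(5) q unfolding z n by simp
    then have "q = q'" "i = i'" by auto
    then have "y = y'" using w(6) w'(6) by (simp add: npair_inject)
    then show "w = w' \<and> v = v'" using w w' px \<open>q = q'\<close> by simp
  qed
  then obtain e where e: "\<And>A w v. U A (e @ w) = Some v \<longleftrightarrow> W A (enc w) (enc v)" by blast
  \<comment> \<open>The 3 is one bit lost by halving a slot plus the difference 2 between n and the
    number of zeros.\<close>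
  have "Kc U z + KA U (halting U) (pair_str x y) \<le> Kc U x + Kc U (pair_str z y) + (c + length e + 3)"
    if "\<forall>t\<ge>t1. g (enc x) t = enc z" for x y z t1
  proof -
    obtain p where p: "length p = Kc U x" "U no_oracle p = Some x"
      using KA_attained[OF universal] unfolding Kc_def by blast
    obtain p' where p': "length p' = Kc U (pair_str z y)" "U no_oracle p' = Some (pair_str z y)"
      using KA_attained[OF universal] unfolding Kc_def by blast
    obtain s where s: "stage s (enc p) = Suc (enc x)" using ex_stage[OF p(2)] by blast
    have "\<exists>t. stage t (enc p') = Suc (npair (enc z) (enc y))"
      using ex_stage[OF p'(2)] by (simp add: enc_pair_str)
    then have "\<exists>t. stage t (enc p') \<noteq> 0" by (metis nat.distinct(1))
    then obtain s' where "stage s' (enc p') \<noteq> 0" and s'_least: "\<forall>t<s'. stage t (enc p') = 0"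
      using exists_least_iff[of "\<lambda>t. stage t (enc p') \<noteq> 0"] by blast
    then obtain v where "stage s' (enc p') = Suc v" using not0_implies_Suc by blast
    then have s': "stage s' (enc p') = Suc (npair (enc z) (enc y))"
      using \<open>\<exists>t. stage t (enc p') = Suc (npair (enc z) (enc y))\<close> stage_unique by metis
    define i where "i = prod_encode (enc p', s')"
    have program_request: "program_request (enc z) i" using s' s'_least by (auto simp: program_request_def i_def hit_iff)
    have "\<exists>t. \<not> halting U (d1 (enc x) t)" unfolding d1_iff using that by (intro exI[of _ t1]) auto
    then obtain t0 where t0: "\<not> halting U (d1 (enc x) t0)" "\<forall>t<t0. halting U (d1 (enc x) t)"
      using exists_least_iff[of "\<lambda>t. \<not> halting U (d1 (enc x) t)"] by blast
    \<comment> \<open>The least t0 need not reach t1, so the outputs at t0 and after t1 are compared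
      at the maximum.\<close>
    have "g (enc x) (max t0 t1) = g (enc x) t0" using t0(1) unfolding d1_iff by (metis max.cobounded1)
    then have "g (enc x) t0 = enc z" using that by simp
    then have lim: "lim (halting U) (enc x) (enc z) t0" using t0 by (simp add: lim_def)
    \<comment> \<open>A positive weight exceeds 2^(1-n) for some n, so a threshold exists.\<close>
    have "0 < weight (Suc i) (enc z)"
    proof -
      have "0 < (1/2::real) ^ program_length i" by simp
      also have "\<dots> \<le> slot_start (program_request (enc z)) program_length (Suc i)"
        using program_request slot_start_nonneg[of "program_request (enc z)" program_length i] by (simp add: slot_start_def)
      also have "\<dots> \<le> weight (Suc i) (enc z)" by (rule slot_start_program_request_le)
      finally show ?thesis .
    qed
    then obtain m where "(1/2::real) ^ m < weight (Suc i) (enc z) / 2"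
      using real_arch_pow_inv[of "weight (Suc i) (enc z) / 2" "1/2"] by auto
    then have "heavy (Suc i) (enc z) m" unfolding heavy_iff by simp
    then have "\<exists>n t. heavy t (enc z) n" by blast
    then obtain n where n: "\<exists>t. heavy t (enc z) n" "\<forall>m<n. \<not> (\<exists>t. heavy t (enc z) m)"
      using exists_least_iff[of "\<lambda>n. \<exists>t. heavy t (enc z) n"] by blast
    then have thr: "thr (halting U) (enc z) n" by (simp add: thr_def d2_iff)
    obtain t where t: "2 * (1/2) ^ n < weight t (enc z)" using n(1) unfolding heavy_iff by blast
    \<comment> \<open>Weights are at most 1, so n = 0 and n = 1 fail the test, and
      \<open>n - 2\<close> is not truncated.\<close>
    have "2 \<le> n"
    proof (rule ccontr)
      assume "\<not> 2 \<le> n"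
      then have "n = 0 \<or> n = 1" by auto
      then have "(1::real) \<le> 2 * (1/2) ^ n" by auto
      then show False using t weight_le_1[of t "enc z"] by linarith
    qed
    then obtain k where k: "n = Suc (Suc k)" by (metis add_2_eq_Suc le_Suc_ex)
    \<comment> \<open>Since n - 1 fails at every stage, the weight never exceeds 2 / 2^(n-1), which
      is 2^-k.\<close>
    have "slot_start (program_request (enc z)) program_length (Suc i) \<le> (1/2) ^ k"
    proof -
      have "\<not> heavy (Suc i) (enc z) (Suc k)" using n(2) k by blast
      then have "weight (Suc i) (enc z) \<le> (1/2) ^ k" unfolding heavy_iff by simp
      then show ?thesis using slot_start_program_request_le order.trans by blast
    qed
    then obtain q where q: "covers (program_request (enc z)) program_length (replicate k False @ q) i"
      "length q + k = Suc (program_length i)"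
      using covers_exists[of "program_request (enc z)", OF program_request] by blast
    have "W (halting U) (enc (p @ q)) (enc (pair_str x y))"
      unfolding W_str
    proof (intro exI conjI)
      show "p @ q = dec (enc p) @ q" by simp
      show "stage s (enc p) = Suc (enc x)" by (rule s)
      show "lim (halting U) (enc x) (enc z) t0" by (rule lim)
      show "thr (halting U) (enc z) n" by (rule thr)
      show "covers (program_request (enc z)) program_length (replicate (n - 2) False @ q) i" using q(1) k by simp
      show "stage (psnd i) (pfst i) = Suc (npair (enc z) (enc y))" using s' by (simp add: i_def)
      show "enc (pair_str x y) = npair (enc x) (enc y)" by (rule enc_pair_str)
    qed
    then have "U (halting U) (e @ p @ q) = Some (pair_str x y)" unfolding e .
    from KA_le[of U, OF this] have "KA U (halting U) (pair_str x y) \<le> length e + Kc U x + length q"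
      using p(1) by simp
    moreover have "length q + k = Suc (Kc U (pair_str z y))"
      using q(2) p'(1) by (simp add: program_length_def i_def)
    moreover have "Kc U z \<le> k + 2 + c" using n(1) c[of _ z n] k by auto
    ultimately show ?thesis by linarith
  qed
  then show ?thesis by blast
qed

text \<open>Meant for the case in which no limit need exist: y is read off a program of a pair whose
  first component is discarded, so nothing has to be asked of the oracle.\<close>

lemma KA_pair_str_le:
  "\<exists>c. \<forall>A x y z. KA U A (pair_str x y) \<le> Kc U x + Kc U (pair_str z y) + c"
proof -
  define W where "W w v \<longleftrightarrow> (\<exists>p q s x z y. w = p * 2 ^ len q + q \<and> stage s p = Suc x
      \<and> stage s q = Suc (npair z y) \<and> v = npair x y)" for w v
  have split: "enc w = p * 2 ^ len q + q \<longleftrightarrow> w = dec p @ dec q" for w p q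
    using enc_append[of "dec p" "dec q"] inj_enc[of w "dec p @ dec q"] len_enc[of "dec q"] by simp
  have "\<exists>e. \<forall>A w v. U A (e @ w) = Some v \<longleftrightarrow> W (enc w) (enc v)"
  proof (rule universal_pf_simulates[OF universal])
    show "semidecidable (\<lambda>A e. W (e 0) (e (Suc 0)))"
      unfolding W_def
      by (intro semidecidable_ex, rule semidecidable_if_decidable,
          intro computable_intros computable_len computable_stage computable_npair)
  next
    fix w w' v v'
    assume "W (enc w) v" and "W (enc w') v'" and pre: "prefix w w'"
    from \<open>W (enc w) v\<close> obtain p q s x z y where w: "w = dec p @ dec q" "stage s p = Suc x"
      "stage s q = Suc (npair z y)" "v = npair x y"
      unfolding W_def split by blast
    from \<open>W (enc w') v'\<close> obtain p' q' s' x' z' y' where w': "w' = dec p' @ dec q'" "stage s' p' = Suc x'"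
      "stage s' q' = Suc (npair z' y')" "v' = npair x' y'"
      unfolding W_def split by blast
    have px: "p = p'" "x = x'" and q: "prefix (dec q) (dec q')"
      using concat_stage_unique[OF w(2) w'(2)] pre unfolding w(1) w'(1) by blast+
    have "q = q'" using stage_prefix_free[OF w(3) w'(3) q] .
    moreover from this have "npair z y = npair z' y'" using stage_unique w(3) w'(3) by blast
    ultimately show "w = w' \<and> v = v'" using w w' px by (simp add: npair_inject)
  qed
  then obtain e where e: "\<And>A w v. U A (e @ w) = Some v \<longleftrightarrow> W (enc w) (enc v)" by blast
  have "KA U A (pair_str x y) \<le> Kc U x + Kc U (pair_str z y) + length e" for A x y z
  proof -
    obtain p where p: "length p = Kc U x" "U no_oracle p = Some x"
      using KA_attained[OF universal] unfolding Kc_def by blast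
    obtain q where q: "length q = Kc U (pair_str z y)" "U no_oracle q = Some (pair_str z y)"
      using KA_attained[OF universal] unfolding Kc_def by blast
    obtain s s' where "stage s (enc p) = Suc (enc x)" "stage s' (enc q) = Suc (npair (enc z) (enc y))"
      using ex_stage[OF p(2)] ex_stage[OF q(2)] by (auto simp: enc_pair_str)
    then have "stage (max s s') (enc p) = Suc (enc x)" "stage (max s s') (enc q) = Suc (npair (enc z) (enc y))"
      using stage_mono by (meson max.cobounded1, meson max.cobounded2)
    then have "W (enc (p @ q)) (enc (pair_str x y))"
      unfolding W_def split enc_pair_str
      by (intro exI[of _ "enc p"] exI[of _ "enc q"] exI[of _ "max s s'"] exI[of _ "enc x"]
          exI[of _ "enc z"] exI[of _ "enc y"]) simp
    then have "U A (e @ p @ q) = Some (pair_str x y)" unfolding e .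
    from KA_le[of U, OF this] show ?thesis using p(1) q(1) by simp
  qed
  then show ?thesis by blast
qed

end

theorem theorem3:
  fixes U :: "(nat \<Rightarrow> bool) \<Rightarrow> bool list \<Rightarrow> bool list option"
    and B :: "bool list \<Rightarrow> bool list"
  assumes "universal_pf U"
    and "limit_computable B"
  shows "\<exists>c::int. \<forall>x y. mutual_info U (B x) y
           < mutual_info U x y + info_halting U (pair_str x y) + c"
proof -
  obtain stage where "staged_universal U stage"
    using ex_staged_universal[OF assms(1)] by blast
  then interpret staged_universal U stage .
  obtain r where total: "\<And>x t. \<exists>v. eval no_oracle r [enc x, t] v"
    and lim: "\<And>x. B x \<noteq> [] \<Longrightarrow> \<exists>t0. \<forall>t\<ge>t0. eval no_oracle r [enc x, t] (enc (B x))"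
    using assms(2) unfolding limit_computable_def by blast
  define g where "g x t = (THE v. eval no_oracle r [x, t] v)" for x t
  have g: "eval no_oracle r [x, t] v \<longleftrightarrow> v = g x t" for x t v
  proof -
    \<comment> \<open>Totality is given at numbers of strings, and every number is one.\<close>
    obtain v0 where "eval no_oracle r [x, t] v0" using total[of "dec x" t] by auto
    then have "eval no_oracle r [x, t] v \<longleftrightarrow> v = v0" for v using eval_deterministic by blast
    then show ?thesis by (simp add: g_def)
  qed
  have "computable (\<lambda>A e. g (e 0) (e (Suc 0)))"
    unfolding computable_def
  proof (intro exI[of _ 2] allI impI)
    fix n :: nat assume "2 \<le> n"
    \<comment> \<open>\<open>g\<close> comes from runs with the empty oracle;
      \<open>oracle_free\<close> repeats them under any A.\<close>
    then have "eval A (Comp (oracle_free r) [Proj 0, Proj 1]) (map e [0..<n]) (g (e 0) (e (Suc 0)))" for A e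
      by (auto simp: eval_Comp_iff eval_Proj_iff eval_oracle_free g list_all2_Cons1)
    then show "\<exists>r. \<forall>A e. eval A r (map e [0..<n]) (g (e 0) (e (Suc 0)))" by blast
  qed
  from conditional_coding[OF this] obtain c1 where
    c1: "\<And>x y z. \<exists>t0. \<forall>t\<ge>t0. g (enc x) t = enc z \<Longrightarrow>
      Kc U z + KA U (halting U) (pair_str x y) \<le> Kc U x + Kc U (pair_str z y) + c1"
    by blast
  obtain c2 where c2: "\<And>A x y z. KA U A (pair_str x y) \<le> Kc U x + Kc U (pair_str z y) + c2"
    using KA_pair_str_le by blast
  \<comment> \<open>If \<open>B x\<close> is empty, its complexity is the constant
    \<open>Kc U []\<close>, paid for here.\<close>
  define c where "c = c1 + c2 + Kc U []"
  have "Kc U (B x) + KA U (halting U) (pair_str x y) \<le> Kc U x + Kc U (pair_str (B x) y) + c" for x y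
  proof (cases "B x = []")
    case True
    then show ?thesis using c2[of "halting U" x y "[]"] by (simp add: c_def)
  next
    case False
    then have "\<exists>t0. \<forall>t\<ge>t0. g (enc x) t = enc (B x)" using lim[of x] g by metis
    from c1[OF this, of y] show ?thesis by (simp add: c_def)
  qed
  then have "int (Kc U (B x)) + int (KA U (halting U) (pair_str x y))
      \<le> int (Kc U x) + int (Kc U (pair_str (B x) y)) + int c" for x y
    by (simp only: of_nat_add[symmetric] of_nat_le_iff)
  \<comment> \<open>The extra 1 makes the bound strict.\<close>
  then have "mutual_info U (B x) y < mutual_info U x y + info_halting U (pair_str x y) + (int c + 1)" for x y
    unfolding mutual_info_def info_halting_def by (smt (verit))
  then show ?thesis by blast
qed

end
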